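(* Let $T>0$, $1\le p\le\infty$, and let $f:[0,T]\times[0,+\infty)\times\mathbb{R}\to\mathbb{R}$ be an $L^p$-Carathéodory function satisfying the conditions $(f_1)$, $(f_2)$, $(f_3)$ listed in the context. Suppose that there exist two constants $r,R>0$, with $r\neq R$, such that the following hypotheses hold. $(H_r)$ The inequality $$\int_0^T\left(\int_0^s f(t,r,0)\,dt\right)ds<0$$ holds. Moreover, for every $\vartheta$ with $0<\vartheta\le 1$, any solution $u$ of the problem $$u''+\vartheta f(t,u,u')=0,\quad 0<t<T,\qquad u(0)=u(T),\quad u'(0)=0,$$ such that $u(t)>0$ for all $t\in[0,T]$, satisfies $\|u\|_\infty\neq r$. $(H_R)$ There exist a non-negative function $v\in L^p([0,T],\mathbb{R})$ with $v\not\equiv0$ and a constant $\alpha_0>0$ such that, for every $\alpha\in[0,\alpha_0]$, every solution $u\ge 0$ of the problem $$u''+f(t,u,u')+\alpha v(t)=0,\quad 0<t<T,\qquad u(0)=u(T),\quad u'(0)=0,$$ satisfies $\|u\|_\infty\neq R$. Moreover, for $\alpha=\alpha_0$ this problem has no solution $u$ with $0\le u(t)\le R$ for all $t\in[0,T]$. Then the problem $$u''+f(t,u,u')=0,\quad 0<t<T,\qquad u(0)=u(T),\quad u'(0)=0,$$ has at least one positive solution $u$ (that is, a solution with $u(t)>0$ for all $t\in[0,T]$) such that $$\min\{r,R\}<\max_{t\in[0,T]}u(t)<\max\{r,R\}.$$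
   Context: Solutions: a solution of any of the boundary value problems is a function $u:[0,T]\to\mathbb{R}$ of class $C^1$ such that $u'$ is absolutely continuous, $u$ satisfies the differential equation for almost every $t\in[0,T]$, and $u$ satisfies the boundary conditions. $\|u\|_\infty=\max_{t\in[0,T]}|u(t)|$. $L^p$-Carathéodory (standard meaning): $f(\cdot,s,\xi)$ is measurable for all $(s,\xi)$, $f(t,\cdot,\cdot)$ is continuous for almost every $t$, and for every $c>0$ there is $g_c\in L^p([0,T])$ with $|f(t,s,\xi)|\le g_c(t)$ for almost every $t$ and all $(s,\xi)$ in the domain with $|s|\le c$, $|\xi|\le c$. Conditions on $f$: $(f_1)$ $f(t,0,\xi)=0$ for almost every $t\in[0,T]$ and every $\xi\in\mathbb{R}$. $(f_2)$ There exist a non-negative function $k\in L^1([0,T])$ and a constant $\rho>0$ such that $|f(t,s,\xi)|\le k(t)(|s|+|\xi|)$ for almost every $t\in[0,T]$, every $0\le s\le\rho$ and every $|\xi|\le\rho$. $(f_3)$ (Bernstein–Nagumo type condition) For each $\eta>0$ there exist a continuous function $\phi=\phi_\eta:[0,+\infty)\to[0,+\infty)$ with $\int^{\infty}\frac{\xi^{(p-1)/p}}{\phi(\xi)}\,d\xi=\infty$ and $\liminf_{\xi\to+\infty}\phi(\xi)>0$, and a function $\psi=\psi_\eta\in L^p([0,T],[0,+\infty))$ such that $|f(t,s,\xi)|\le\psi(t)\phi(|\xi|)$ for almost every $t\in[0,T]$, all $s\in[0,\eta]$ and all $\xi\in\mathbb{R}$. (Here $(p-1)/p$ is read as $1$ if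 $p=\infty$, and $\int^\infty$ denotes the integral over a neighbourhood of $+\infty$.) *)

theory Defs
  imports "HOL-Analysis.Analysis"
begin

definition absolutely_continuous_on_interval :: "real \<Rightarrow> real \<Rightarrow> (real \<Rightarrow> real) \<Rightarrow> bool" where
  "absolutely_continuous_on_interval a b w \<longleftrightarrow>
     (\<forall>\<epsilon>>0. \<exists>\<delta>>0. \<forall>(n::nat) (x::nat \<Rightarrow> real) (y::nat \<Rightarrow> real).
        (\<forall>i<n. a \<le> x i \<and> x i \<le> y i \<and> y i \<le> b) \<longrightarrow>
        disjoint_family_on (\<lambda>i. {x i<..<y i}) {..<n} \<longrightarrow>
        (\<Sum>i<n. y i - x i) < \<delta> \<longrightarrow>
        (\<Sum>i<n. \<bar>w (y i) - w (x i)\<bar>) < \<epsilon>)"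

text \<open>Membership in L^p([0,T]) for \<open>1 \<le> p \<le> \<infinity>\<close>. Elements are represented by functions, so sign
  conditions and vanishing of L^p functions are stated almost everywhere.\<close>

definition in_Lp :: "ennreal \<Rightarrow> real \<Rightarrow> (real \<Rightarrow> real) \<Rightarrow> bool" where
  "in_Lp p T g \<longleftrightarrow>
     g \<in> borel_measurable (lebesgue_on {0..T}) \<and>
     (if p = \<infinity> then \<exists>C. AE t in lebesgue_on {0..T}. \<bar>g t\<bar> \<le> C
      else integrable (lebesgue_on {0..T}) (\<lambda>t. \<bar>g t\<bar> powr enn2real p))"

text \<open>Throughout, \<open>f t s \<xi>\<close> is relevant only for \<open>0 \<le> t \<le> T\<close>, \<open>0 \<le> s\<close> and real \<open>\<xi>\<close>; its
  values elsewhere are unconstrained.\<close>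

definition Lp_caratheodory :: "ennreal \<Rightarrow> real \<Rightarrow> (real \<Rightarrow> real \<Rightarrow> real \<Rightarrow> real) \<Rightarrow> bool" where
  "Lp_caratheodory p T f \<longleftrightarrow>
     (\<forall>s\<ge>0. \<forall>\<xi>. (\<lambda>t. f t s \<xi>) \<in> borel_measurable (lebesgue_on {0..T})) \<and>
     (AE t in lebesgue_on {0..T}. continuous_on ({0..} \<times> UNIV) (\<lambda>(s, \<xi>). f t s \<xi>)) \<and>
     (\<forall>c>0. \<exists>g. in_Lp p T g \<and>
        (AE t in lebesgue_on {0..T}. \<forall>s \<xi>. 0 \<le> s \<longrightarrow> \<bar>s\<bar> \<le> c \<longrightarrow> \<bar>\<xi>\<bar> \<le> c \<longrightarrow> \<bar>f t s \<xi>\<bar> \<le> g t))"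

definition cond_f1 :: "real \<Rightarrow> (real \<Rightarrow> real \<Rightarrow> real \<Rightarrow> real) \<Rightarrow> bool" where
  "cond_f1 T f \<longleftrightarrow> (AE t in lebesgue_on {0..T}. \<forall>\<xi>. f t 0 \<xi> = 0)"

definition cond_f2 :: "real \<Rightarrow> (real \<Rightarrow> real \<Rightarrow> real \<Rightarrow> real) \<Rightarrow> bool" where
  "cond_f2 T f \<longleftrightarrow>
     (\<exists>k \<rho>. in_Lp 1 T k \<and> (AE t in lebesgue_on {0..T}. 0 \<le> k t) \<and> \<rho> > 0 \<and>
        (AE t in lebesgue_on {0..T}. \<forall>s \<xi>. 0 \<le> s \<longrightarrow> s \<le> \<rho> \<longrightarrow> \<bar>\<xi>\<bar> \<le> \<rho> \<longrightarrow>
           \<bar>f t s \<xi>\<bar> \<le> k t * (\<bar>s\<bar> + \<bar>\<xi>\<bar>)))"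

definition nagumo_exponent :: "ennreal \<Rightarrow> real" where
  "nagumo_exponent p = (if p = \<infinity> then 1 else (enn2real p - 1) / enn2real p)"

text \<open>The Bernstein--Nagumo condition. The divergence at infinity is required for the integral over
  \<open>[a, \<infinity>)\<close> with \<open>a\<close> large, so that possible zeros of \<open>\<phi>\<close> (which form a bounded set, because the
  lower limit is positive) play no role.\<close>

definition cond_f3 :: "ennreal \<Rightarrow> real \<Rightarrow> (real \<Rightarrow> real \<Rightarrow> real \<Rightarrow> real) \<Rightarrow> bool" where
  "cond_f3 p T f \<longleftrightarrow>
     (\<forall>\<eta>>0. \<exists>\<phi> \<psi>.
        continuous_on {0..} \<phi> \<and> (\<forall>\<xi>\<ge>0. 0 \<le> \<phi> \<xi>) \<and>
        (\<forall>\<^sub>F a in at_top.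
           (\<integral>\<^sup>+\<xi>\<in>{a..}. ennreal (\<xi> powr nagumo_exponent p / \<phi> \<xi>) \<partial>lborel) = \<infinity>) \<and>
        0 < Liminf at_top (\<lambda>\<xi>. ereal (\<phi> \<xi>)) \<and>
        in_Lp p T \<psi> \<and> (AE t in lebesgue_on {0..T}. 0 \<le> \<psi> t) \<and>
        (AE t in lebesgue_on {0..T}. \<forall>s \<xi>. 0 \<le> s \<longrightarrow> s \<le> \<eta> \<longrightarrow> \<bar>f t s \<xi>\<bar> \<le> \<psi> t * \<phi> \<bar>\<xi>\<bar>))"

text \<open>Solutions of \<open>u'' + F(t,u,u') = 0\<close>, \<open>u(0) = u(T)\<close>, \<open>u'(0) = 0\<close> on \<open>[0,T]\<close>. Here \<open>du\<close> is
  the derivative of \<open>u\<close> on \<open>[0,T]\<close> (one-sided at the end points) and \<open>d2u\<close> the almost everywhere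
  derivative of \<open>du\<close>.\<close>

definition bvp_solution ::
  "real \<Rightarrow> (real \<Rightarrow> real \<Rightarrow> real \<Rightarrow> real) \<Rightarrow> (real \<Rightarrow> real) \<Rightarrow> bool" where
  "bvp_solution T F u \<longleftrightarrow>
     (\<exists>du d2u.
        (\<forall>t\<in>{0..T}. (u has_real_derivative du t) (at t within {0..T})) \<and>
        continuous_on {0..T} du \<and>
        absolutely_continuous_on_interval 0 T du \<and>
        (AE t in lebesgue_on {0..T}.
           (du has_real_derivative d2u t) (at t within {0..T}) \<and> d2u t + F t (u t) (du t) = 0) \<and>
        u 0 = u T \<and> du 0 = 0)"

text \<open>For continuous \<open>u\<close> and \<open>T > 0\<close> the supremum is the maximum of \<open>\<bar>u\<bar>\<close> on \<open>[0,T]\<close>.\<close>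

definition sup_norm_on :: "real \<Rightarrow> (real \<Rightarrow> real) \<Rightarrow> real" where
  "sup_norm_on T u = (SUP t\<in>{0..T}. \<bar>u t\<bar>)"

text \<open>The integrals are taken with respect to the completed measure \<open>lebesgue\<close>, since
  \<open>t \<mapsto> f t r 0\<close> is only assumed Lebesgue measurable.\<close>

definition cond_Hr :: "real \<Rightarrow> (real \<Rightarrow> real \<Rightarrow> real \<Rightarrow> real) \<Rightarrow> real \<Rightarrow> bool" where
  "cond_Hr T f r \<longleftrightarrow>
     (LINT s:{0..T}|lebesgue. (LINT t:{0..s}|lebesgue. f t r 0)) < 0 \<and>
     (\<forall>\<theta> u. 0 < \<theta> \<longrightarrow> \<theta> \<le> 1 \<longrightarrow>
        bvp_solution T (\<lambda>t s \<xi>. \<theta> * f t s \<xi>) u \<longrightarrow> (\<forall>t\<in>{0..T}. 0 < u t) \<longrightarrow>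
        sup_norm_on T u \<noteq> r)"

definition cond_HR :: "ennreal \<Rightarrow> real \<Rightarrow> (real \<Rightarrow> real \<Rightarrow> real \<Rightarrow> real) \<Rightarrow> real \<Rightarrow> bool" where
  "cond_HR p T f R \<longleftrightarrow>
     (\<exists>v \<alpha>\<^sub>0. in_Lp p T v \<and> (AE t in lebesgue_on {0..T}. 0 \<le> v t) \<and>
        \<not> (AE t in lebesgue_on {0..T}. v t = 0) \<and> \<alpha>\<^sub>0 > 0 \<and>
        (\<forall>\<alpha>\<in>{0..\<alpha>\<^sub>0}. \<forall>u. bvp_solution T (\<lambda>t s \<xi>. f t s \<xi> + \<alpha> * v t) u \<longrightarrow>
           (\<forall>t\<in>{0..T}. 0 \<le> u t) \<longrightarrow> sup_norm_on T u \<noteq> R) \<and>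
        \<not> (\<exists>u. bvp_solution T (\<lambda>t s \<xi>. f t s \<xi> + \<alpha>\<^sub>0 * v t) u \<and>
             (\<forall>t\<in>{0..T}. 0 \<le> u t \<and> u t \<le> R)))"

end

(* Because of the condition u'(0) = 0 the problem can be treated by shooting from the single real
   parameter c = u(0), so that the degree of a real function replaces the coincidence degree.
   Solutions need not be unique, hence the shooting map is formed with an Euler scheme, which is
   continuous in c; by Arzela-Ascoli the limits of the scheme are exact solutions, so the exclusion
   hypotheses (H_r), (H_R) hold for a sufficiently fine scheme. Letting theta increase from 0 to 1 on
   the region where the sup norm is below r, where the signs at c = r and c = -r give degree 1, and
   then alpha from 0 to alpha_0 on the region where it is below R, where no solution remains, one
   finds degrees 1 and 0; so some solution at theta = 1, alpha = 0 has its norm between r and R.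
   Beforehand the nonlinearity is truncated and extended to s < 0 by a restoring term: a maximum
   principle gives u >= 0, the Bernstein-Nagumo condition bounds u', and (f_2) makes 0 the only
   solution with u = u' = 0 at some point, which gives u > 0. *)
theory Submission
  imports Defs "HOL-Complex_Analysis.Great_Picard"
begin

subsection \<open>Indefinite Lebesgue integrals\<close>

text \<open>The degenerate end of the homotopy is \<theta> = 0: there every constant solves the
  problem and u(T) = u(0) says nothing. As u(T) - u(0) carries a factor \<theta>, the condition is
  divided by it. At c = r what remains is the iterated integral of (H_r), which is negative; at c =
  -r only the restoring term is left, since (f_1) removes f for s < 0, and the sign is opposite. The
  hypotheses exclude values of the sup norm, not of c. Hence the two degrees live on sublevel sets
  of the norm of the trajectory, regions in the plane of c and the homotopy parameter whose shape is
  not known. At \<theta> = 1, \<alpha> = 0 these sublevel sets differ by the annulus between r and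
  R, so the cases r < R and R < r need no distinction. The bound M on u' is fixed before \<theta>
  and \<alpha> and is uniform in both. It rests on an inequality of Young type whose linear term in
  |u'| integrates to the oscillation of u; this is how an L^p bound suffices without Hoelder's
  inequality. Solutions of norm at most max r R therefore never notice the truncation.\<close>

lemma AE_lebesgue_on_iff_negligible:
  fixes a b :: real
  shows "(AE t in lebesgue_on {a..b}. P t) \<longleftrightarrow> (\<exists>N. negligible N \<and> (\<forall>t\<in>{a..b} - N. P t))"
proof -
  have "(AE t in lebesgue_on {a..b}. P t) \<longleftrightarrow> (AE t in lebesgue. t \<in> {a..b} \<longrightarrow> P t)"
    by (rule AE_restrict_space_iff) simp
  also have "\<dots> \<longleftrightarrow> (\<exists>N. negligible N \<and> (\<forall>t\<in>{a..b} - N. P t))"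
  proof
    assume "AE t in lebesgue. t \<in> {a..b} \<longrightarrow> P t"
    then have "negligible {t. \<not> (t \<in> {a..b} \<longrightarrow> P t)}"
      by (simp add: completion.AE_iff_null_sets negligible_iff_null_sets)
    then show "\<exists>N. negligible N \<and> (\<forall>t\<in>{a..b} - N. P t)" by blast
  next
    assume "\<exists>N. negligible N \<and> (\<forall>t\<in>{a..b} - N. P t)"
    then obtain N where N: "N \<in> null_sets lebesgue" "\<And>t. t \<in> {a..b} \<Longrightarrow> t \<notin> N \<Longrightarrow> P t"
      by (auto simp: negligible_iff_null_sets)
    show "AE t in lebesgue. t \<in> {a..b} \<longrightarrow> P t"
      using AE_not_in[OF N(1)] by eventually_elim (use N(2) in auto)
  qed
  finally show ?thesis .
qed

text \<open>In dimension one the cubes of \<open>integrable_ccontinuous_explicit\<close>, which have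
  x as lower corner, are the intervals to the right of x. This is the one-sided Lebesgue
  differentiation theorem.\<close>

lemma indefinite_integral_right_derivative:
  fixes h :: "real \<Rightarrow> real"
  assumes "\<And>a b. h integrable_on {a..b}"
  obtains N where "negligible N"
    "\<And>x e. x \<notin> N \<Longrightarrow> 0 < e \<Longrightarrow>
       \<exists>d>0. \<forall>y. x < y \<and> y < x + d \<longrightarrow> \<bar>integral {x..y} h / (y - x) - h x\<bar> < e"
proof -
  obtain N where N: "negligible N" "\<And>x e. x \<notin> N \<Longrightarrow> 0 < e \<Longrightarrow>
       \<exists>d>0. \<forall>k. 0 < k \<and> k < d \<longrightarrow>
         norm (integral (cbox x (x + k *\<^sub>R One)) h /\<^sub>R k ^ DIM(real) - h x) < e"
    using integrable_ccontinuous_explicit[of h] assms by (metis box_real(2))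
  show thesis
  proof (rule that[OF N(1)])
    fix x e :: real assume "x \<notin> N" "0 < e"
    from N(2)[OF this] obtain d where d: "d > 0" "\<And>k. 0 < k \<Longrightarrow> k < d \<Longrightarrow>
        \<bar>integral {x..x + k} h / k - h x\<bar> < e"
      by (auto simp: divide_inverse mult.commute)
    have "\<bar>integral {x..y} h / (y - x) - h x\<bar> < e" if "x < y \<and> y < x + d" for y
      using d(2)[of "y - x"] that by simp
    with d(1) show "\<exists>d>0. \<forall>y. x < y \<and> y < x + d \<longrightarrow> \<bar>integral {x..y} h / (y - x) - h x\<bar> < e"
      by blast
  qed
qed

theorem indefinite_integral_has_real_derivative_AE:
  fixes h :: "real \<Rightarrow> real"
  assumes h: "h integrable_on {a..b}"
  shows "AE t in lebesgue_on {a..b}.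
           ((\<lambda>x. integral {a..x} h) has_real_derivative h t) (at t within {a..b})"
proof -
  \<comment> \<open>Extension by zero makes the function integrable on every interval, as the
    one-sided lemma demands of it and of its reflection.\<close>
  define H where "H x = (if x \<in> {a..b} then h x else 0)" for x
  have Hint: "H integrable_on {c..d}" for c d
  proof -
    have "H integrable_on UNIV"
      unfolding H_def using h integrable_restrict_UNIV[of "{a..b}" h] by (simp del: atLeastAtMost_iff)
    then show ?thesis
      by (metis box_real(2) integrable_on_subcbox subset_UNIV)
  qed
  \<comment> \<open>Left difference quotients of the integral of \<open>H\<close> are right ones for
    the reflection; its exceptional set is mapped back by \<open>uminus\<close>.\<close>
  have Hint': "(\<lambda>x. H (- x)) integrable_on {c..d}" for c d
    using Hint[of "-d" "-c"] Henstock_Kurzweil_Integration.integrable_reflect_real[where f=H and a="-d" and b="-c"] by simp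
  obtain N1 where N1: "negligible N1" "\<And>x e. x \<notin> N1 \<Longrightarrow> 0 < e \<Longrightarrow>
       \<exists>d>0. \<forall>y. x < y \<and> y < x + d \<longrightarrow> \<bar>integral {x..y} H / (y - x) - H x\<bar> < e"
    using indefinite_integral_right_derivative[OF Hint] by metis
  obtain N2 where N2: "negligible N2" "\<And>x e. x \<notin> N2 \<Longrightarrow> 0 < e \<Longrightarrow>
       \<exists>d>0. \<forall>y. x < y \<and> y < x + d \<longrightarrow>
         \<bar>integral {x..y} (\<lambda>x. H (- x)) / (y - x) - H (- x)\<bar> < e"
    using indefinite_integral_right_derivative[OF Hint'] by metis
  define N where "N = N1 \<union> uminus ` N2 \<union> {a, b}"
  have "negligible (uminus ` N2)"
    by (rule negligible_differentiable_image_negligible[OF _ N2(1)])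
       (auto intro!: derivative_intros)
  then have negN: "negligible N"
    unfolding N_def using N1(1) by auto
  have der: "((\<lambda>x. integral {a..x} h) has_real_derivative h t) (at t within {a..b})"
    if t: "t \<in> {a..b}" "t \<notin> N" for t
  proof -
    have tab: "a < t" "t < b" and tN: "t \<notin> N1" "- t \<notin> N2"
      using t by (auto simp: N_def image_iff)
    have Hh: "integral {x..y} H = integral {x..y} h" if "a \<le> x" "y \<le> b" for x y
      by (rule integral_cong) (use that in \<open>auto simp: H_def\<close>)
    have split: "integral {a..y} h - integral {a..x} h = integral {x..y} h"
      if "a \<le> x" "x \<le> y" "y \<le> b" for x y
      using Henstock_Kurzweil_Integration.integral_combine[of a x y h] that
        integrable_on_subinterval[OF h, of a y] by auto
    show ?thesis
      unfolding has_field_derivative_iff Lim_within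
    proof (intro allI impI)
      fix e :: real assume "e > 0"
      obtain d1 where d1: "d1 > 0" "\<And>y. t < y \<Longrightarrow> y < t + d1 \<Longrightarrow>
          \<bar>integral {t..y} H / (y - t) - H t\<bar> < e"
        using N1(2)[OF tN(1) \<open>e > 0\<close>] by blast
      obtain d2 where d2: "d2 > 0" "\<And>y. - t < y \<Longrightarrow> y < - t + d2 \<Longrightarrow>
          \<bar>integral {- t..y} (\<lambda>x. H (- x)) / (y - - t) - H (- (- t))\<bar> < e"
        using N2(2)[OF tN(2) \<open>e > 0\<close>] by blast
      have Ht: "H t = h t"
        using t by (simp add: H_def)
      have "dist ((integral {a..y} h - integral {a..t} h) / (y - t)) (h t) < e"
        if y: "y \<in> {a..b}" "0 < dist y t" "dist y t < min d1 d2" for y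
      proof (cases "t < y")
        case True
        then show ?thesis
          using d1(2)[of y] y split[of t y] Hh[of t y] tab Ht by (simp add: dist_real_def)
      next
        case False
        then have "y < t" using y by (auto simp: dist_real_def)
        have "integral {- t..- y} (\<lambda>x. H (- x)) = integral {y..t} H"
          using integral_reflect_real[of t y H] by simp
        moreover have "integral {a..y} h - integral {a..t} h = - integral {y..t} h"
          using split[of y t] y tab \<open>y < t\<close> by simp
        moreover have "(- integral {y..t} h) / (y - t) = integral {y..t} h / (t - y)"
          by (metis minus_diff_eq minus_divide_divide)
        ultimately show ?thesis
          using d2(2)[of "- y"] y Hh[of y t] tab \<open>y < t\<close> Ht
          by (simp add: dist_real_def)
      qed
      then show "\<exists>d>0. \<forall>y\<in>{a..b}. 0 < dist y t \<and> dist y t < d \<longrightarrow>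
          dist ((integral {a..y} h - integral {a..t} h) / (y - t)) (h t) < e"
        using d1(1) d2(1) by (intro exI[of _ "min d1 d2"]) auto
    qed
  qed
  show ?thesis
    unfolding AE_lebesgue_on_iff_negligible using negN der by blast
qed

text \<open>Cut g at a height k for which the excess q = g - min g k has integral below \<epsilon> /
  2. Disjoint intervals collect at most \<epsilon> / 2 from q, and from the bounded part at most k
  times their total length.\<close>

lemma absolutely_continuous_on_interval_integral:
  assumes g: "g integrable_on {a..b}" and g0: "\<And>t. t \<in> {a..b} \<Longrightarrow> 0 \<le> g t"
    and w: "\<And>s t. a \<le> s \<Longrightarrow> s \<le> t \<Longrightarrow> t \<le> b \<Longrightarrow> \<bar>w t - w s\<bar> \<le> integral {s..t} g"
  shows "absolutely_continuous_on_interval a b w"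
  unfolding absolutely_continuous_on_interval_def
proof (intro allI impI)
  fix \<epsilon> :: real assume "\<epsilon> > 0"
  define m where "m k t = min (g t) (real k)" for k :: nat and t
  have gabs: "g absolutely_integrable_on {a..b}"
    using g g0 by (intro nonnegative_absolutely_integrable_1) auto
  have mint: "m k integrable_on {a..b}" for k
    unfolding m_def
    by (intro set_lebesgue_integral_eq_integral(1) absolutely_integrable_min_1 gabs)
       (auto intro: absolutely_integrable_continuous_real)
  have "(\<lambda>k. integral {a..b} (m k)) \<longlonglongrightarrow> integral {a..b} g"
  proof (rule dominated_convergence(2)[OF mint g])
    show "norm (m k x) \<le> g x" if "x \<in> {a..b}" for k x
      using g0[OF that] by (simp add: m_def)
    show "(\<lambda>k. m k x) \<longlonglongrightarrow> g x" if "x \<in> {a..b}" for x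
    proof (rule tendsto_eventually)
      obtain K :: nat where "g x \<le> K" using real_arch_simple by blast
      then show "\<forall>\<^sub>F k in sequentially. m k x = g x"
        by (intro eventually_sequentiallyI[of K]) (auto simp: m_def)
    qed
  qed
  then obtain k where k: "\<bar>integral {a..b} (m k) - integral {a..b} g\<bar> < \<epsilon> / 2"
    using \<open>\<epsilon> > 0\<close> by (metis LIMSEQ_iff half_gt_zero order_refl real_norm_def)
  define q where "q t = g t - m k t" for t
  have qint: "q integrable_on {a..b}"
    unfolding q_def using g mint by (intro integrable_diff) auto
  have q0: "q t \<ge> 0" for t by (simp add: q_def m_def)
  have qI: "integral {a..b} q < \<epsilon> / 2"
    unfolding q_def using k Henstock_Kurzweil_Integration.integral_diff[OF g mint[of k]] by linarith
  show "\<exists>\<delta>>0. \<forall>(n::nat) x y. (\<forall>i<n. a \<le> x i \<and> x i \<le> y i \<and> y i \<le> b) \<longrightarrow>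
          disjoint_family_on (\<lambda>i. {x i<..<y i}) {..<n} \<longrightarrow>
          (\<Sum>i<n. y i - x i) < \<delta> \<longrightarrow> (\<Sum>i<n. \<bar>w (y i) - w (x i)\<bar>) < \<epsilon>"
  \<comment> \<open>The summand 1 covers the case k = 0.\<close>
  proof (rule exI[of _ "\<epsilon> / (2 * (real k + 1))"], intro conjI allI impI)
    show "\<epsilon> / (2 * (real k + 1)) > 0" using \<open>\<epsilon> > 0\<close> by simp
  next
    fix n :: nat and x y :: "nat \<Rightarrow> real"
    assume xy: "\<forall>i<n. a \<le> x i \<and> x i \<le> y i \<and> y i \<le> b"
      and disj: "disjoint_family_on (\<lambda>i. {x i<..<y i}) {..<n}"
      and small: "(\<Sum>i<n. y i - x i) < \<epsilon> / (2 * (real k + 1))"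
    have sub: "{x i..y i} \<subseteq> {a..b}" if "i < n" for i using xy that by auto
    have UN: "(q has_integral (\<Sum>i<n. integral {x i<..<y i} q)) (\<Union>i<n. {x i<..<y i})"
    proof (rule has_integral_UN)
      show "(q has_integral integral {x i<..<y i} q) {x i<..<y i}" if "i \<in> {..<n}" for i
        using integrable_on_subinterval[OF qint sub[of i]] that
        by (simp add: integrable_integral integrable_on_open_interval_real)
      show "pairwise (\<lambda>i i'. negligible ({x i<..<y i} \<inter> {x i'<..<y i'})) {..<n}"
        using disj by (auto simp: disjoint_family_on_def pairwise_def)
    qed auto
    have each: "\<bar>w (y i) - w (x i)\<bar> \<le> integral {x i<..<y i} q + real k * (y i - x i)" if "i < n" for i
    proof -
      have i1: "q integrable_on {x i..y i}" and i2: "m k integrable_on {x i..y i}"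
        using integrable_on_subinterval[OF _ sub[OF that]] qint mint by auto
      have "\<bar>w (y i) - w (x i)\<bar> \<le> integral {x i..y i} g" using w xy that by auto
      also have "\<dots> = integral {x i..y i} (\<lambda>t. q t + m k t)" by (simp add: q_def)
      also have "\<dots> = integral {x i..y i} q + integral {x i..y i} (m k)"
        by (rule Henstock_Kurzweil_Integration.integral_add[OF i1 i2])
      also have "integral {x i..y i} (m k) \<le> integral {x i..y i} (\<lambda>_. real k)"
        by (rule integral_le[OF i2]) (auto simp: m_def)
      finally show ?thesis
        using xy that by (simp add: integral_open_interval_real mult.commute)
    qed
    have "(\<Sum>i<n. \<bar>w (y i) - w (x i)\<bar>) \<le>
        (\<Sum>i<n. integral {x i<..<y i} q) + real k * (\<Sum>i<n. y i - x i)"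
      using sum_mono[of "{..<n}" "\<lambda>i. \<bar>w (y i) - w (x i)\<bar>", OF each]
      by (simp add: sum.distrib sum_distrib_left)
    also have "(\<Sum>i<n. integral {x i<..<y i} q) = integral (\<Union>i<n. {x i<..<y i}) q"
      by (rule integral_unique[OF UN, symmetric])
    also have "\<dots> \<le> integral {a..b} q"
    proof (rule integral_subset_le[OF _ _ qint])
      show "(\<Union>i<n. {x i<..<y i}) \<subseteq> {a..b}" using sub by fastforce
      show "q integrable_on (\<Union>i<n. {x i<..<y i})"
        using UN by blast
    qed (use q0 in auto)
    also have "\<dots> < \<epsilon> / 2" by (rule qI)
    also have "real k * (\<Sum>i<n. y i - x i) \<le> \<epsilon> / 2"
    proof -
      have "real k * (\<Sum>i<n. y i - x i) \<le> (real k + 1) * (\<epsilon> / (2 * (real k + 1)))"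
        using small xy by (intro mult_mono) (auto intro!: sum_nonneg)
      also have "\<dots> = \<epsilon> / 2" by (simp add: divide_simps)
      finally show ?thesis .
    qed
    finally show "(\<Sum>i<n. \<bar>w (y i) - w (x i)\<bar>) < \<epsilon>" by simp
  qed
qed

subsection \<open>Euler schemes for Caratheodory systems\<close>

lemma uniform_limit_compose_tendsto:
  fixes G :: "nat \<Rightarrow> 'a::metric_space \<Rightarrow> 'b::real_normed_vector"
  assumes G: "uniform_limit S G g sequentially" and g: "continuous_on S g"
    and x: "x \<in> S" "\<And>n. X n \<in> S" "X \<longlonglongrightarrow> x"
  shows "(\<lambda>n. G n (X n)) \<longlonglongrightarrow> g x"
proof -
  have 1: "(\<lambda>n. g (X n)) \<longlonglongrightarrow> g x"
    using x by (intro continuous_on_tendsto_compose[OF g]) auto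
  have 2: "(\<lambda>n. G n (X n) - g (X n)) \<longlonglongrightarrow> 0"
  proof (rule tendstoI)
    fix e :: real assume "e > 0"
    from uniform_limitD[OF G this]
    show "\<forall>\<^sub>F n in sequentially. dist (G n (X n) - g (X n)) 0 < e"
      by eventually_elim (use x in \<open>auto simp: dist_norm\<close>)
  qed
  show ?thesis
    using tendsto_add[OF 2 1] by simp
qed

text \<open>Trajectories always start at 0, so the starting value of a shot has to be carried by the
  parameter p. One integrable g dominates the field for all states and parameters; it yields
  equicontinuity of the Euler polygons as well as dominated convergence.\<close>

locale caratheodory_system =
  fixes T :: real and F :: "real \<Rightarrow> 'p::euclidean_space \<Rightarrow> 'y::euclidean_space \<Rightarrow> 'y"
    and g :: "real \<Rightarrow> real"
  assumes T_pos: "T > 0"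
    and F_integrable: "\<And>p y. (\<lambda>t. F t p y) integrable_on {0..T}"
    and F_bound: "\<And>t p y. t \<in> {0..T} \<Longrightarrow> norm (F t p y) \<le> g t"
    and g_integrable: "g integrable_on {0..T}"
    and F_cont: "\<And>t. t \<in> {0..T} \<Longrightarrow> continuous_on UNIV (\<lambda>(p, y). F t p y)"
begin

definition solution :: "'p \<Rightarrow> (real \<Rightarrow> 'y) \<Rightarrow> bool" where
  "solution p Y \<longleftrightarrow> continuous_on {0..T} Y \<and>
     (\<forall>t\<in>{0..T}. ((\<lambda>s. F s p (Y s)) has_integral Y t) {0..t})"

definition node :: "nat \<Rightarrow> nat \<Rightarrow> real" where
  "node n i = T * real i / real n"

text \<open>The Euler scheme freezes only the state, not the time variable, on each subinterval, so its nodes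
  depend continuously on the parameter although the system need not have unique solutions.\<close>

primrec euler :: "nat \<Rightarrow> 'p \<Rightarrow> nat \<Rightarrow> 'y" where
  "euler n p 0 = 0"
| "euler n p (Suc i) = euler n p i + integral {node n i..node n (Suc i)} (\<lambda>s. F s p (euler n p i))"

definition index :: "nat \<Rightarrow> real \<Rightarrow> nat" where
  "index n s = nat \<lfloor>s * real n / T\<rfloor>"

definition slope :: "nat \<Rightarrow> 'p \<Rightarrow> real \<Rightarrow> 'y" where
  "slope n p s = F s p (euler n p (index n s))"

lemma g_nonneg: "t \<in> {0..T} \<Longrightarrow> 0 \<le> g t"
  using F_bound[of t undefined undefined] norm_ge_zero order_trans by blast

lemma F_continuous_at: 
  assumes "t \<in> {0..T}" "P \<longlonglongrightarrow> p" "Y \<longlonglongrightarrow> y"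
  shows "(\<lambda>n. F t (P n) (Y n)) \<longlonglongrightarrow> F t p y"
proof -
  have "(\<lambda>n. (P n, Y n)) \<longlonglongrightarrow> (p, y)"
    using assms by (intro tendsto_Pair)
  then have "(\<lambda>n. (\<lambda>(p, y). F t p y) (P n, Y n)) \<longlonglongrightarrow> (\<lambda>(p, y). F t p y) (p, y)"
    by (rule continuous_on_tendsto_compose[OF F_cont[OF assms(1)]]) auto
  then show ?thesis by simp
qed

lemma node_mono: "i \<le> j \<Longrightarrow> node n i \<le> node n j"
  using T_pos by (auto simp: node_def intro!: divide_right_mono mult_left_mono)

lemma node_in: "i \<le> n \<Longrightarrow> node n i \<in> {0..T}"
proof -
  assume "i \<le> n"
  then have "T * real i \<le> T * real n" using T_pos by simp
  then show ?thesis
    using T_pos by (cases "n = 0") (auto simp: node_def pos_divide_le_eq)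
qed

lemma index_eq:
  assumes "n > 0" "node n i \<le> s" "s < node n (Suc i)"
  shows "index n s = i"
proof -
  have "real i \<le> s * real n / T" "s * real n / T < real i + 1"
    using assms T_pos
    by (simp_all add: node_def pos_divide_le_eq pos_le_divide_eq pos_divide_less_eq
        pos_less_divide_eq algebra_simps)
  then have "\<lfloor>s * real n / T\<rfloor> = int i" by linarith
  then show ?thesis by (simp add: index_def)
qed

lemma index_le: "n > 0 \<Longrightarrow> s \<le> T \<Longrightarrow> index n s \<le> n"
proof -
  assume "n > 0" "s \<le> T"
  then have "s * real n / T \<le> real n"
    using T_pos by (simp add: divide_simps mult.commute mult_left_mono)
  then have "\<lfloor>s * real n / T\<rfloor> \<le> int n" by linarith
  then show ?thesis by (simp add: index_def)
qed

lemma index_node_bound: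
  assumes "n > 0" "0 \<le> s"
  shows "\<bar>node n (index n s) - s\<bar> \<le> T / real n"
proof -
  define z where "z = s * real n / T"
  have "z \<ge> 0" using assms T_pos by (simp add: z_def)
  then have "real (index n s) \<le> z" "z \<le> real (index n s) + 1"
    unfolding index_def z_def[symmetric] by linarith+
  then have "\<bar>real (index n s) - z\<bar> \<le> 1" by linarith
  then have "T / real n * \<bar>real (index n s) - z\<bar> \<le> T / real n * 1"
    using T_pos by (intro mult_left_mono) auto
  moreover have "T / real n * \<bar>real (index n s) - z\<bar> = \<bar>T / real n * (real (index n s) - z)\<bar>"
    using T_pos by (simp add: abs_mult)
  moreover have "T / real n * (real (index n s) - z) = node n (index n s) - s"
    using T_pos assms by (simp add: node_def z_def field_simps)
  ultimately show ?thesis by (metis mult.right_neutral)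
qed

lemma continuous_euler: "i \<le> n \<Longrightarrow> continuous_on UNIV (\<lambda>p. euler n p i)"
proof (induction i)
  case 0
  then show ?case by simp
next
  case (Suc i)
  let ?S = "{node n i..node n (Suc i)}"
  have S: "?S \<subseteq> {0..T}"
    using node_in[of i n] node_in[of "Suc i" n] Suc.prems by auto
  have "continuous_on UNIV (\<lambda>p. integral ?S (\<lambda>s. F s p (euler n p i)))"
    unfolding continuous_on_sequentially
  proof (intro allI ballI impI)
    fix P :: "nat \<Rightarrow> 'p" and p assume "(\<forall>n. P n \<in> UNIV) \<and> P \<longlonglongrightarrow> p"
    then have P: "P \<longlonglongrightarrow> p" by simp
    have E: "(\<lambda>k. euler n (P k) i) \<longlonglongrightarrow> euler n p i"
      using continuous_on_tendsto_compose[OF Suc.IH P] Suc.prems by simp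
    show "((\<lambda>p. integral ?S (\<lambda>s. F s p (euler n p i))) \<circ> P) \<longlonglongrightarrow>
           integral ?S (\<lambda>s. F s p (euler n p i))"
      unfolding comp_def
    proof (rule dominated_convergence(2)[where h = g])
      show "(\<lambda>s. F s (P k) (euler n (P k) i)) integrable_on ?S" for k
        by (rule integrable_on_subinterval[OF F_integrable S])
      show "g integrable_on ?S"
        by (rule integrable_on_subinterval[OF g_integrable S])
      show "norm (F x (P k) (euler n (P k) i)) \<le> g x" if "x \<in> ?S" for k x
        using F_bound S that by blast
      show "(\<lambda>k. F x (P k) (euler n (P k) i)) \<longlonglongrightarrow> F x p (euler n p i)" if "x \<in> ?S" for x
        by (rule F_continuous_at[OF _ P E]) (use S that in auto)
    qed
  qed
  with Suc show ?case by (auto intro!: continuous_on_add)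
qed

lemma euler_has_integral:
  assumes "n > 0" "i \<le> n"
  shows "(slope n p has_integral euler n p i) {0..node n i}"
  using assms(2)
proof (induction i)
  case 0
  then show ?case using has_integral_refl(2)[of "slope n p" 0] by (simp add: node_def)
next
  case (Suc i)
  let ?S = "{node n i..node n (Suc i)}"
  have S: "?S \<subseteq> {0..T}"
    using node_in[of i n] node_in[of "Suc i" n] Suc.prems by auto
  have "((\<lambda>s. F s p (euler n p i)) has_integral
          integral ?S (\<lambda>s. F s p (euler n p i))) ?S"
    by (intro integrable_integral integrable_on_subinterval[OF F_integrable S])
  \<comment> \<open>At the right end node the index already jumps to \<open>Suc i\<close>, so slope
    and frozen field agree only up to that point.\<close>
  then have "(slope n p has_integral integral ?S (\<lambda>s. F s p (euler n p i))) ?S"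
    by (rule has_integral_spike_finite[of "{node n (Suc i)}", rotated 2])
       (use index_eq[OF assms(1), of i] in \<open>auto simp: slope_def\<close>)
  then show ?case
    using has_integral_combine[of 0 "node n i" "node n (Suc i)" "slope n p"] Suc
      node_in[of i n] node_mono[of i "Suc i" n] by auto
qed

lemma slope_integrable: "n > 0 \<Longrightarrow> slope n p integrable_on {0..T}"
  using euler_has_integral[of n n p] by (auto simp: node_def has_integral_iff)

lemma slope_bound: "t \<in> {0..T} \<Longrightarrow> norm (slope n p t) \<le> g t"
  unfolding slope_def by (rule F_bound)

definition interpolant :: "nat \<Rightarrow> 'p \<Rightarrow> real \<Rightarrow> 'y" where
  "interpolant n p t = integral {0..t} (slope n p)"

lemma interpolant_node: "n > 0 \<Longrightarrow> i \<le> n \<Longrightarrow> interpolant n p (node n i) = euler n p i"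
  unfolding interpolant_def using euler_has_integral by (rule integral_unique)

lemma interpolant_diff:
  assumes "n > 0" "0 \<le> s" "s \<le> t" "t \<le> T"
  shows "norm (interpolant n p t - interpolant n p s) \<le> integral {0..t} g - integral {0..s} g"
proof -
  have int: "slope n p integrable_on {0..t}" "g integrable_on {0..t}"
    "slope n p integrable_on {s..t}" "g integrable_on {s..t}"
    using assms by (auto intro: integrable_on_subinterval[OF slope_integrable]
        integrable_on_subinterval[OF g_integrable])
  have "interpolant n p t - interpolant n p s = integral {s..t} (slope n p)"
    unfolding interpolant_def
    using Henstock_Kurzweil_Integration.integral_combine[OF assms(2,3) int(1)]
    by (simp add: algebra_simps)
  also have "norm \<dots> \<le> integral {s..t} g"
    by (rule integral_norm_bound_integral[OF int(3,4)]) (use slope_bound assms in auto)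
  also have "\<dots> = integral {0..t} g - integral {0..s} g"
    using Henstock_Kurzweil_Integration.integral_combine[OF assms(2,3) int(2)]
    by (simp add: algebra_simps)
  finally show ?thesis .
qed

text \<open>The primitive of g is a common modulus of continuity whatever the parameters are, so the
  sequence \<open>P\<close> may be arbitrary here.\<close>

lemma Ascoli_interpolants:
  assumes n: "\<And>k. N k > 0"
  obtains Y \<kappa> where "continuous_on {0..T} Y" "strict_mono (\<kappa> :: nat \<Rightarrow> nat)"
    "uniform_limit {0..T} (\<lambda>k. interpolant (N (\<kappa> k)) (P (\<kappa> k))) Y sequentially"
proof -
  define G where "G t = integral {0..t} g" for t
  have Gc: "continuous_on {0..T} G"
    unfolding G_def by (rule indefinite_integral_continuous_1[OF g_integrable])
  have diff: "norm (interpolant (N k) (P k) t - interpolant (N k) (P k) s) \<le> \<bar>G t - G s\<bar>"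
    if "s \<in> {0..T}" "t \<in> {0..T}" for s t k
  proof (cases "s \<le> t")
    case True
    then show ?thesis
      using interpolant_diff[OF n[of k], of s t "P k"] that by (simp add: G_def)
  next
    case False
    then show ?thesis
      using interpolant_diff[OF n[of k], of t s "P k"] that by (simp add: G_def norm_minus_commute)
  qed
  obtain Y \<kappa> where Y: "continuous_on {0..T} Y" "strict_mono (\<kappa> :: nat \<Rightarrow> nat)"
    "\<And>e. 0 < e \<Longrightarrow> \<exists>K. \<forall>k x. k \<ge> K \<and> x \<in> {0..T} \<longrightarrow>
        norm (interpolant (N (\<kappa> k)) (P (\<kappa> k)) x - Y x) < e"
  proof (rule Arzela_Ascoli[of "{0..T}" "\<lambda>k. interpolant (N k) (P k)" "G T"])
    show "norm (interpolant (N k) (P k) x) \<le> G T" if "x \<in> {0..T}" for k x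
    proof -
      have "norm (interpolant (N k) (P k) x) \<le> G x"
        using interpolant_diff[OF n[of k], of 0 x "P k"] that
        by (simp add: G_def interpolant_def)
      also have "G x \<le> G T"
        unfolding G_def using that g_nonneg
        by (intro integral_subset_le integrable_on_subinterval[OF g_integrable] g_integrable) auto
      finally show ?thesis .
    qed
    show "\<exists>d>0. \<forall>k y. y \<in> {0..T} \<and> norm (x - y) < d \<longrightarrow>
        norm (interpolant (N k) (P k) x - interpolant (N k) (P k) y) < e"
      if x: "x \<in> {0..T}" and "0 < e" for x e
    proof -
      obtain d where d: "d > 0" "\<And>y. y \<in> {0..T} \<Longrightarrow> dist y x < d \<Longrightarrow> dist (G y) (G x) < e"
        using Gc x \<open>0 < e\<close> unfolding continuous_on_iff by metis
      have "norm (interpolant (N k) (P k) x - interpolant (N k) (P k) y) < e"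
        if "y \<in> {0..T}" "norm (x - y) < d" for k y
        using diff[OF that(1) x, of k] d(2)[OF that(1)] that(2)
        by (simp add: dist_real_def abs_minus_commute)
      then show ?thesis
        using d(1) by blast
    qed
  qed (auto simp: that)
  have "uniform_limit {0..T} (\<lambda>k. interpolant (N (\<kappa> k)) (P (\<kappa> k))) Y sequentially"
    unfolding uniform_limit_sequentially_iff dist_norm using Y(3) by meson
  with Y(1,2) show thesis by (rule that)
qed

text \<open>The state frozen at time s is the value of the interpolant at a node within T / N of s,
  and by uniform convergence it tends to \<open>Y s\<close>. The slopes then converge pointwise, and
  dominated convergence gives the integral equation.\<close>

lemma limit_is_solution:
  assumes n: "\<And>k. N k > 0" and N: "filterlim N at_top sequentially"
    and P: "P \<longlonglongrightarrow> p"
    and Y: "continuous_on {0..T} Y" "uniform_limit {0..T} (\<lambda>k. interpolant (N k) (P k)) Y sequentially"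
  shows "solution p Y"
  unfolding solution_def
proof (intro conjI ballI)
  have tN: "(\<lambda>k. T / real (N k)) \<longlonglongrightarrow> 0"
    using filterlim_compose[OF lim_inverse_n N, THEN tendsto_mult_right_zero, of T]
    by (simp add: divide_inverse)
  have ind: "node (N k) (index (N k) s) \<in> {0..T}" if "s \<in> {0..T}" for s k
    using node_in index_le[OF n] that by auto
  have nd: "(\<lambda>k. node (N k) (index (N k) s)) \<longlonglongrightarrow> s" if "s \<in> {0..T}" for s
  proof -
    have "(\<lambda>k. node (N k) (index (N k) s) - s) \<longlonglongrightarrow> 0"
      by (rule Lim_null_comparison[OF _ tN])
         (use index_node_bound[OF n, of s] that in auto)
    then show ?thesis by (simp add: LIM_zero_iff)
  qed
  have eul: "(\<lambda>k. euler (N k) (P k) (index (N k) s)) \<longlonglongrightarrow> Y s" if "s \<in> {0..T}" for s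
    using uniform_limit_compose_tendsto[OF Y(2,1) that ind[OF that] nd[OF that]]
      interpolant_node[OF n index_le[OF n], of s] that by simp
  have sl: "(\<lambda>k. slope (N k) (P k) s) \<longlonglongrightarrow> F s p (Y s)" if "s \<in> {0..T}" for s
    unfolding slope_def by (rule F_continuous_at[OF that P eul[OF that]])
  fix t assume t: "t \<in> {0..T}"
  then have sub: "{0..t} \<subseteq> {0..T}" by auto
  note dc = dominated_convergence[of "\<lambda>k. slope (N k) (P k)" "{0..t}" g "\<lambda>s. F s p (Y s)",
      OF integrable_on_subinterval[OF slope_integrable[OF n] sub]
        integrable_on_subinterval[OF g_integrable sub] slope_bound sl]
  have "(\<lambda>k. interpolant (N k) (P k) t) \<longlonglongrightarrow> Y t"
    using tendsto_uniform_limitI[OF Y(2) t] .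
  moreover have "(\<lambda>k. interpolant (N k) (P k) t) \<longlonglongrightarrow> integral {0..t} (\<lambda>s. F s p (Y s))"
    unfolding interpolant_def by (rule dc(2)) (use t in auto)
  ultimately have "Y t = integral {0..t} (\<lambda>s. F s p (Y s))"
    by (rule LIMSEQ_unique)
  moreover have "(\<lambda>s. F s p (Y s)) integrable_on {0..t}"
    by (rule dc(1)) (use t in auto)
  ultimately show "((\<lambda>s. F s p (Y s)) has_integral Y t) {0..t}"
    by (simp add: has_integral_iff)
qed (rule Y(1))

text \<open>If every scheme failed with tolerance 1 / n, a subsequence of the offending polygons
  would converge to an exact solution whose data lie in the closed set C. Letting z range over an
  \<epsilon>-ball around the Euler end point makes the conclusion quantitative and uniform in
  p.\<close>

theorem euler_avoids_closed:
  fixes K :: "'p set" and C :: "('p \<times> real \<times> 'y) set" and \<nu> :: "'p \<Rightarrow> 'y \<Rightarrow> real"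
  assumes K: "compact K" and C: "closed C"
    and \<nu>: "continuous_on UNIV (\<lambda>(p, y). \<nu> p y)"
    and avoid: "\<And>p Y \<tau>. p \<in> K \<Longrightarrow> solution p Y \<Longrightarrow> \<tau> \<in> {0..T} \<Longrightarrow>
        (\<And>t. t \<in> {0..T} \<Longrightarrow> \<nu> p (Y t) \<le> \<nu> p (Y \<tau>)) \<Longrightarrow> (p, \<nu> p (Y \<tau>), Y T) \<notin> C"
  obtains n \<epsilon> where "n > 0" "\<epsilon> > 0"
    "\<And>p z. p \<in> K \<Longrightarrow> dist z (euler n p n) < \<epsilon> \<Longrightarrow>
        (p, Max ((\<lambda>i. \<nu> p (euler n p i)) ` {..n}), z) \<notin> C"
proof (rule ccontr)
  define X where "X n p = Max ((\<lambda>i. \<nu> p (euler n p i)) ` {..n})" for n p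
  assume "\<not> thesis"
  with that have "\<exists>p z. p \<in> K \<and> dist z (euler (Suc k) p (Suc k)) < 1 / real (Suc k) \<and>
      (p, X (Suc k) p, z) \<in> C" for k
    unfolding X_def by (metis divide_pos_pos of_nat_0_less_iff zero_less_Suc zero_less_one)
  then obtain P Z where PZ: "\<And>k. P k \<in> K"
    "\<And>k. dist (Z k) (euler (Suc k) (P k) (Suc k)) < 1 / real (Suc k)"
    "\<And>k. (P k, X (Suc k) (P k), Z k) \<in> C"
    by metis
  have "\<exists>i\<in>{..Suc k}. X (Suc k) (P k) = \<nu> (P k) (euler (Suc k) (P k) i)" for k
  proof -
    have "X (Suc k) (P k) \<in> (\<lambda>i. \<nu> (P k) (euler (Suc k) (P k) i)) ` {..Suc k}"
      unfolding X_def by (rule Max_in) (simp, blast)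
    then show ?thesis by blast
  qed
  then obtain I where I: "\<And>k. I k \<le> Suc k"
    "\<And>k. X (Suc k) (P k) = \<nu> (P k) (euler (Suc k) (P k) (I k))"
    by (metis atMost_iff)
  have Xge: "\<nu> (P k) (euler (Suc k) (P k) i) \<le> X (Suc k) (P k)" if "i \<le> Suc k" for k i
    unfolding X_def using that by (intro Max_ge) auto
  \<comment> \<open>The node that realises the discrete maximum is extracted together with the
    parameter; its limit \<tau> becomes a maximum point of the limit trajectory.\<close>
  have "compact (K \<times> {0..T})" by (intro compact_Times K) simp
  moreover have "(P k, node (Suc k) (I k)) \<in> K \<times> {0..T}" for k
    using PZ(1) node_in[OF I(1)] by auto
  ultimately obtain p\<tau> \<kappa>1 where \<kappa>1: "p\<tau> \<in> K \<times> {0..T}" "strict_mono (\<kappa>1 :: nat \<Rightarrow> nat)"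
    "((\<lambda>k. (P k, node (Suc k) (I k))) \<circ> \<kappa>1) \<longlonglongrightarrow> p\<tau>"
    unfolding compact_def by meson
  obtain p \<tau> where p\<tau>: "p\<tau> = (p, \<tau>)" by fastforce
  obtain Y \<kappa>2 where Y: "continuous_on {0..T} Y" "strict_mono (\<kappa>2 :: nat \<Rightarrow> nat)"
    "uniform_limit {0..T} (\<lambda>k. interpolant (Suc (\<kappa>1 (\<kappa>2 k))) (P (\<kappa>1 (\<kappa>2 k)))) Y sequentially"
    using Ascoli_interpolants[of "\<lambda>k. Suc (\<kappa>1 k)" "\<lambda>k. P (\<kappa>1 k)"] by auto
  define \<kappa> where "\<kappa> = \<kappa>1 \<circ> \<kappa>2"
  have \<kappa>: "strict_mono \<kappa>"
    unfolding \<kappa>_def by (rule strict_mono_o[OF \<kappa>1(2) Y(2)])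
  have lim: "(\<lambda>k. (P (\<kappa> k), node (Suc (\<kappa> k)) (I (\<kappa> k)))) \<longlonglongrightarrow> (p, \<tau>)"
    using LIMSEQ_subseq_LIMSEQ[OF \<kappa>1(3) Y(2)] by (simp add: \<kappa>_def comp_def p\<tau>)
  have P: "(\<lambda>k. P (\<kappa> k)) \<longlonglongrightarrow> p" and \<tau>lim: "(\<lambda>k. node (Suc (\<kappa> k)) (I (\<kappa> k))) \<longlonglongrightarrow> \<tau>"
    using tendsto_fst[OF lim] tendsto_snd[OF lim] by simp_all
  have U: "uniform_limit {0..T} (\<lambda>k. interpolant (Suc (\<kappa> k)) (P (\<kappa> k))) Y sequentially"
    using Y(3) by (simp add: \<kappa>_def)
  have N: "filterlim (\<lambda>k. Suc (\<kappa> k)) at_top sequentially"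
    by (rule filterlim_compose[OF filterlim_Suc filterlim_subseq[OF \<kappa>]])
  have sol: "solution p Y"
    by (rule limit_is_solution[OF _ N P Y(1) U]) simp
  have \<tau>: "\<tau> \<in> {0..T}" and pK: "p \<in> K" using \<kappa>1(1) p\<tau> by auto
  have \<nu>lim: "(\<lambda>k. \<nu> (P (\<kappa> k)) (E k)) \<longlonglongrightarrow> \<nu> p y" if "E \<longlonglongrightarrow> y" for E y
  proof -
    have "(\<lambda>k. (P (\<kappa> k), E k)) \<longlonglongrightarrow> (p, y)"
      using P that by (intro tendsto_Pair)
    then have "(\<lambda>k. (\<lambda>(p, y). \<nu> p y) (P (\<kappa> k), E k)) \<longlonglongrightarrow> (\<lambda>(p, y). \<nu> p y) (p, y)"
      by (rule continuous_on_tendsto_compose[OF \<nu>]) auto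
    then show ?thesis by simp
  qed
  have Xlim: "(\<lambda>k. X (Suc (\<kappa> k)) (P (\<kappa> k))) \<longlonglongrightarrow> \<nu> p (Y \<tau>)"
    unfolding I(2)
    by (rule \<nu>lim)
       (use uniform_limit_compose_tendsto[OF U Y(1) \<tau> node_in[OF I(1)] \<tau>lim]
          interpolant_node[OF _ I(1)] in simp)
  \<comment> \<open>For fixed t the nodes given by \<open>index\<close> tend to t, and at each of
    them \<nu> is at most the discrete maximum.\<close>
  have max: "\<nu> p (Y t) \<le> \<nu> p (Y \<tau>)" if t: "t \<in> {0..T}" for t
  proof (rule LIMSEQ_le[OF _ Xlim])
    let ?i = "\<lambda>k. index (Suc (\<kappa> k)) t"
    have ile: "?i k \<le> Suc (\<kappa> k)" for k using index_le[of "Suc (\<kappa> k)" t] t by simp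
    have "(\<lambda>k. node (Suc (\<kappa> k)) (?i k) - t) \<longlonglongrightarrow> 0"
    proof (rule Lim_null_comparison)
      show "(\<lambda>k. T / real (Suc (\<kappa> k))) \<longlonglongrightarrow> 0"
        using filterlim_compose[OF lim_inverse_n N, THEN tendsto_mult_right_zero, of T]
        by (simp add: divide_inverse)
      show "\<forall>\<^sub>F k in sequentially. norm (node (Suc (\<kappa> k)) (?i k) - t) \<le> T / real (Suc (\<kappa> k))"
        using index_node_bound[of "Suc _" t] t by (intro always_eventually allI) auto
    qed
    then have "(\<lambda>k. node (Suc (\<kappa> k)) (?i k)) \<longlonglongrightarrow> t" by (simp add: LIM_zero_iff)
    from uniform_limit_compose_tendsto[OF U Y(1) t node_in[OF ile] this]
    show "(\<lambda>k. \<nu> (P (\<kappa> k)) (euler (Suc (\<kappa> k)) (P (\<kappa> k)) (?i k))) \<longlonglongrightarrow> \<nu> p (Y t)"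
      using interpolant_node[OF _ ile] by (intro \<nu>lim) simp
    show "\<exists>K. \<forall>k\<ge>K. \<nu> (P (\<kappa> k)) (euler (Suc (\<kappa> k)) (P (\<kappa> k)) (?i k)) \<le> X (Suc (\<kappa> k)) (P (\<kappa> k))"
      using Xge[OF ile] by blast
  qed
  have Elim: "(\<lambda>k. euler (Suc (\<kappa> k)) (P (\<kappa> k)) (Suc (\<kappa> k))) \<longlonglongrightarrow> Y T"
  proof -
    have "euler (Suc (\<kappa> k)) (P (\<kappa> k)) (Suc (\<kappa> k)) = interpolant (Suc (\<kappa> k)) (P (\<kappa> k)) T" for k
      using interpolant_node[of "Suc (\<kappa> k)" "Suc (\<kappa> k)" "P (\<kappa> k)"] by (simp add: node_def)
    then show ?thesis
      using tendsto_uniform_limitI[OF U, of T] T_pos by simp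
  qed
  have "(\<lambda>k. Z (\<kappa> k) - euler (Suc (\<kappa> k)) (P (\<kappa> k)) (Suc (\<kappa> k))) \<longlonglongrightarrow> 0"
  proof (rule Lim_null_comparison)
    show "(\<lambda>k. 1 / real (Suc (\<kappa> k))) \<longlonglongrightarrow> 0"
      using filterlim_compose[OF lim_inverse_n N] by (simp add: divide_inverse)
    show "\<forall>\<^sub>F k in sequentially. norm (Z (\<kappa> k) - euler (Suc (\<kappa> k)) (P (\<kappa> k)) (Suc (\<kappa> k)))
        \<le> 1 / real (Suc (\<kappa> k))"
      using PZ(2) by (intro always_eventually allI) (metis dist_norm less_imp_le)
  qed
  from tendsto_add[OF this Elim] have Zlim: "(\<lambda>k. Z (\<kappa> k)) \<longlonglongrightarrow> Y T"
    by simp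
  have "(\<lambda>k. (P (\<kappa> k), X (Suc (\<kappa> k)) (P (\<kappa> k)), Z (\<kappa> k))) \<longlonglongrightarrow> (p, \<nu> p (Y \<tau>), Y T)"
    by (intro tendsto_Pair P Xlim Zlim)
  then have "(p, \<nu> p (Y \<tau>), Y T) \<in> C"
    by (rule closed_sequentially[OF C PZ(3)])
  with avoid[OF pK sol \<tau> max] show False by blast
qed

end

subsection \<open>Degree of a real function\<close>

text \<open>With this profile the point of angle pi * (1 + \<open>clamp1 x\<close>) runs once around
  the unit circle while x crosses [-1, 1] and rests at 1 outside.\<close>

definition clamp1 :: "real \<Rightarrow> real" where
  "clamp1 x = max (-1) (min 1 x)"

lemma continuous_on_clamp1 [continuous_intros]:
  "continuous_on S f \<Longrightarrow> continuous_on S (\<lambda>x. clamp1 (f x))"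
  unfolding clamp1_def by (intro continuous_intros)

lemma exp_clamp1_eq_1:
  assumes "\<epsilon> > 0" "\<epsilon> \<le> \<bar>x\<bar>"
  shows "exp (\<i> * of_real (pi * (1 + clamp1 (x / \<epsilon>)))) = 1"
proof (cases "x > 0")
  case True
  then have "1 \<le> x / \<epsilon>" using assms by (simp add: divide_simps)
  then have "clamp1 (x / \<epsilon>) = 1" by (simp add: clamp1_def)
  then show ?thesis using exp_two_pi_i by (simp add: mult_ac)
next
  case False
  then have "x / \<epsilon> \<le> -1" using assms by (simp add: divide_simps)
  then have "clamp1 (x / \<epsilon>) = -1" by (simp add: clamp1_def)
  then show ?thesis by simp
qed

text \<open>Such a phase takes values in the discrete set of multiples of 2 * pi.\<close>

lemma continuous_phase_constant:
  fixes \<Lambda> :: "real \<Rightarrow> real"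
  assumes "a \<le> b" "continuous_on {a..b} \<Lambda>" "\<And>t. t \<in> {a..b} \<Longrightarrow> exp (\<i> * of_real (\<Lambda> t)) = 1"
  shows "\<Lambda> a = \<Lambda> b"
proof -
  have fin: "\<exists>n::int. \<Lambda> t / (2 * pi) = of_int n" if "t \<in> {a..b}" for t
  proof -
    from assms(3)[OF that] obtain n :: int where "\<Lambda> t = of_int (2 * n) * pi"
      unfolding exp_eq_1 by auto
    then show ?thesis by (intro exI[of _ n]) (simp add: field_simps)
  qed
  have "(\<lambda>t. \<Lambda> t / (2 * pi)) constant_on {a..b}"
  proof (rule continuous_discrete_range_constant)
    show "continuous_on {a..b} (\<lambda>t. \<Lambda> t / (2 * pi))"
      by (intro continuous_intros assms(2)) auto
    fix t assume t: "t \<in> {a..b}"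
    show "\<exists>e>0. \<forall>y. y \<in> {a..b} \<and> \<Lambda> y / (2 * pi) \<noteq> \<Lambda> t / (2 * pi) \<longrightarrow>
        e \<le> norm (\<Lambda> y / (2 * pi) - \<Lambda> t / (2 * pi))"
    proof (intro exI[of _ 1] conjI allI impI)
      fix y assume y: "y \<in> {a..b} \<and> \<Lambda> y / (2 * pi) \<noteq> \<Lambda> t / (2 * pi)"
      from fin[OF t] obtain n :: int where n: "\<Lambda> t / (2 * pi) = of_int n" by blast
      from fin y obtain m :: int where m: "\<Lambda> y / (2 * pi) = of_int m" by blast
      have "m \<noteq> n" using y n m by auto
      then have "1 \<le> \<bar>m - n\<bar>" by linarith
      then have "1 \<le> \<bar>real_of_int m - of_int n\<bar>" by linarith
      then show "1 \<le> norm (\<Lambda> y / (2 * pi) - \<Lambda> t / (2 * pi))" unfolding n m by simp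
    qed simp
  qed simp
  then have "\<Lambda> a / (2 * pi) = \<Lambda> b / (2 * pi)"
    unfolding constant_on_def using assms(1) by (metis atLeastAtMost_iff order_refl)
  then show ?thesis by simp
qed

text \<open>Read \<open>X (c, \<sigma>)\<close> as the sup norm of the trajectory shot from \<open>c\<close> and \<open>F\<close> as its shooting defect.
  On the region \<open>X \<le> r\<close> (for \<open>\<sigma> \<le> 1\<close>), \<open>X \<le> R\<close> (for \<open>\<sigma> \<ge> 1\<close>) the defect is wrapped around the unit
  circle, everything else is sent to 1. A continuous phase of this map is constant on the left, right
  and top edges of the rectangle, whereas it increases by \<open>2 * pi\<close> along the bottom edge: this is
  homotopy invariance of the degree of a real function, in the form of Pontryagin and Thom.\<close>

theorem no_degree_jump:
  fixes F X :: "real \<times> real \<Rightarrow> real"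
  assumes F: "continuous_on UNIV F" and X: "continuous_on UNIV X" and "\<epsilon> > 0"
    and r: "0 < r" "r < L" "R < L"
    and X_ge: "\<And>c \<sigma>. \<bar>c\<bar> \<le> X (c, \<sigma>)" and X_0: "\<And>c. X (c, 0) = \<bar>c\<bar>"
    and bdry_r: "\<And>c \<sigma>. 0 \<le> \<sigma> \<Longrightarrow> \<sigma> \<le> 1 \<Longrightarrow> X (c, \<sigma>) = r \<Longrightarrow> \<epsilon> \<le> \<bar>F (c, \<sigma>)\<bar>"
    and between: "\<And>c. min r R \<le> X (c, 1) \<Longrightarrow> X (c, 1) \<le> max r R \<Longrightarrow> \<epsilon> \<le> \<bar>F (c, 1)\<bar>"
    and bdry_R: "\<And>c \<sigma>. 1 \<le> \<sigma> \<Longrightarrow> \<sigma> \<le> 2 \<Longrightarrow> X (c, \<sigma>) = R \<Longrightarrow> \<epsilon> \<le> \<bar>F (c, \<sigma>)\<bar>"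
    and top: "\<And>c. X (c, 2) \<le> R \<Longrightarrow> \<epsilon> \<le> \<bar>F (c, 2)\<bar>"
    and right: "\<epsilon> \<le> F (r, 0)" and left: "F (-r, 0) \<le> -\<epsilon>"
  shows False
proof -
  define Q where "Q = {-L..L} \<times> {0..2::real}"
  define A where "A = {z. snd z \<le> 1 \<and> X z \<le> r \<or> 1 \<le> snd z \<and> X z \<le> R}"
  define B where "B = {z. snd z \<le> 1 \<and> r \<le> X z \<or> 1 \<le> snd z \<and> R \<le> X z}"
  define E where "E z = exp (\<i> * of_real (pi * (1 + clamp1 (F z / \<epsilon>))))" for z
  define \<gamma> where "\<gamma> z = (if z \<in> A then E z else 1)" for z
  have clos: "closed A" "closed B"
    unfolding A_def B_def
    by (intro closed_Collect_disj closed_Collect_conj closed_Collect_le X continuous_intros)+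
  have closQ: "closed Q" unfolding Q_def by (intro closed_Times) auto
  \<comment> \<open>Within Q the sets \<open>A\<close> and \<open>B\<close> overlap only where X = r
    (for \<sigma> < 1), where X = R (for \<sigma> > 1), and on the closed annulus at \<sigma> = 1.
    That \<open>E\<close> is 1 there glues the two pieces of \<gamma>; the annulus is where
    \<open>between\<close> enters.\<close>
  have E1: "E z = 1" if "z \<in> Q \<inter> A" "z \<in> B" for z
  proof -
    obtain c \<sigma> where z: "z = (c, \<sigma>)" by fastforce
    have "\<epsilon> \<le> \<bar>F (c, \<sigma>)\<bar>"
      using that bdry_r[of \<sigma> c] bdry_R[of \<sigma> c] between[of c]
      unfolding z A_def B_def Q_def by (cases "\<sigma> = 1") (auto simp: min_le_iff_disj le_max_iff_disj)
    then show ?thesis unfolding E_def z by (rule exp_clamp1_eq_1[OF \<open>\<epsilon> > 0\<close>])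
  qed
  have "continuous_on ((Q \<inter> A) \<union> (Q \<inter> B)) \<gamma>"
    unfolding \<gamma>_def
  proof (rule continuous_on_cases)
    show "continuous_on (Q \<inter> A) E"
      unfolding E_def using \<open>\<epsilon> > 0\<close>
      by (intro continuous_intros continuous_on_subset[OF F]) auto
  qed (use clos closQ E1 in auto)
  moreover have "(Q \<inter> A) \<union> (Q \<inter> B) = Q"
    unfolding A_def B_def by auto
  ultimately have "continuous_on Q \<gamma>" by simp
  moreover have "\<gamma> \<in> Q \<rightarrow> sphere 0 1"
    by (auto simp: \<gamma>_def E_def norm_exp_i_times)
  moreover have "Borsukian Q"
    unfolding Q_def by (intro convex_imp_Borsukian convex_Times) auto
  ultimately obtain \<Lambda> where \<Lambda>: "continuous_on Q (complex_of_real \<circ> \<Lambda>)"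
      "\<And>z. z \<in> Q \<Longrightarrow> \<gamma> z = exp (\<i> * of_real (\<Lambda> z))"
    unfolding Borsukian_continuous_logarithm_circle_real by blast
  have \<Lambda>c: "continuous_on Q \<Lambda>"
    using continuous_on_Re[OF \<Lambda>(1)] by simp
  \<comment> \<open>X is at least |c| = L there and L exceeds both radii, so the side edges lie
    outside \<open>A\<close>.\<close>
  have \<gamma>side: "\<gamma> (c, \<sigma>) = 1" if "\<bar>c\<bar> = L" for c \<sigma>
    using that r X_ge[of c \<sigma>] by (auto simp: \<gamma>_def A_def)
  have \<gamma>top: "\<gamma> (c, 2) = 1" for c
    using top[of c] exp_clamp1_eq_1[OF \<open>\<epsilon> > 0\<close>] by (auto simp: \<gamma>_def A_def E_def)
  have L: "L > 0" using r by simp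
  have vert: "\<Lambda> (c, 0) = \<Lambda> (c, 2)" if "\<bar>c\<bar> = L" for c
  proof (rule continuous_phase_constant[where \<Lambda> = "\<lambda>\<sigma>. \<Lambda> (c, \<sigma>)"])
    have "(\<lambda>\<sigma>. (c, \<sigma>)) ` {0..2} \<subseteq> Q" using that L by (auto simp: Q_def)
    then show "continuous_on {0..2} (\<lambda>\<sigma>. \<Lambda> (c, \<sigma>))"
      by (intro continuous_on_compose2[OF \<Lambda>c] continuous_intros)
    show "exp (\<i> * of_real (\<Lambda> (c, t))) = 1" if "t \<in> {0..2}" for t
    proof -
      have "(c, t) \<in> Q" using \<open>\<bar>c\<bar> = L\<close> that by (auto simp: Q_def)
      then show ?thesis using \<Lambda>(2) \<gamma>side[OF \<open>\<bar>c\<bar> = L\<close>] by metis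
    qed
  qed simp
  have horiz: "\<Lambda> (-L, 2) = \<Lambda> (L, 2)"
  proof (rule continuous_phase_constant[where \<Lambda> = "\<lambda>c. \<Lambda> (c, 2)"])
    show "continuous_on {-L..L} (\<lambda>c. \<Lambda> (c, 2))"
      by (intro continuous_on_compose2[OF \<Lambda>c] continuous_intros) (auto simp: Q_def)
    show "exp (\<i> * of_real (\<Lambda> (t, 2))) = 1" if "t \<in> {-L..L}" for t
      using \<Lambda>(2)[of "(t, 2)"] \<gamma>top[of t] that by (auto simp: Q_def)
  qed (use L in simp)
  \<comment> \<open>On the bottom edge \<open>A\<close> is the segment |c| \<le> r, with explicit
    phase pi * (1 + h). Clipping c continues h by its end values, which again give the point 1, so
    \<Lambda> and the explicit phase differ by a constant along the whole edge.\<close>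
  define h where "h c = clamp1 (F (max (-r) (min r c), 0) / \<epsilon>)" for c
  have "\<Lambda> (-L, 0) - pi * (1 + h (-L)) = \<Lambda> (L, 0) - pi * (1 + h L)"
  proof (rule continuous_phase_constant[where \<Lambda> = "\<lambda>c. \<Lambda> (c, 0) - pi * (1 + h c)"])
    show "continuous_on {-L..L} (\<lambda>c. \<Lambda> (c, 0) - pi * (1 + h c))"
      unfolding h_def
      by (intro continuous_intros continuous_on_compose2[OF \<Lambda>c] continuous_on_compose2[OF F])
         (use \<open>\<epsilon> > 0\<close> in \<open>auto simp: Q_def\<close>)
    show "exp (\<i> * of_real (\<Lambda> (t, 0) - pi * (1 + h t))) = 1" if t: "t \<in> {-L..L}" for t
    proof -
      have "\<gamma> (t, 0) = exp (\<i> * of_real (pi * (1 + h t)))"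
      proof (cases "\<bar>t\<bar> \<le> r")
        case True
        then have "max (-r) (min r t) = t" by auto
        with True show ?thesis by (simp add: \<gamma>_def A_def X_0 E_def h_def)
      next
        case False
        then have "max (-r) (min r t) = r \<or> max (-r) (min r t) = - r" using r by auto
        then have "\<epsilon> \<le> \<bar>F (max (-r) (min r t), 0)\<bar>" using left right \<open>\<epsilon> > 0\<close> by auto
        from exp_clamp1_eq_1[OF \<open>\<epsilon> > 0\<close> this] False show ?thesis
          by (simp add: \<gamma>_def A_def X_0 h_def)
      qed
      then show ?thesis
        using \<Lambda>(2)[of "(t, 0)"] t by (auto simp: Q_def exp_diff right_diff_distrib)
    qed
  qed (use L in simp)
  \<comment> \<open>The explicit phase gains 2 * pi from -L to L, whereas the other three edges
    force equal values of \<Lambda> at the two bottom corners.\<close>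
  moreover have "h L = 1" "h (-L) = -1"
    using r left right \<open>\<epsilon> > 0\<close> by (auto simp: h_def clamp1_def min_def max_def divide_simps)
  moreover have "\<Lambda> (-L, 0) = \<Lambda> (L, 0)"
    using vert[of L] vert[of "-L"] horiz L by simp
  ultimately show False using pi_gt_zero by simp
qed

subsection \<open>A priori estimates\<close>

text \<open>Serves when increments can be compared only on short steps: steps of equal length below
  \<delta> are chained.\<close>

lemma mono_from_uniform_local:
  fixes Z :: "real \<Rightarrow> real"
  assumes "a \<le> b" "\<delta> > 0"
    and loc: "\<And>s t. a \<le> s \<Longrightarrow> s \<le> t \<Longrightarrow> t \<le> b \<Longrightarrow> t - s < \<delta> \<Longrightarrow> Z s \<le> Z t"
  shows "Z a \<le> Z b"
proof -
  obtain n :: nat where n: "n > 0" "(b - a) / real n < \<delta>"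
  proof -
    obtain n where "(b - a) / \<delta> < real (Suc n)"
      using reals_Archimedean2 by (metis less_trans lessI of_nat_less_iff)
    then have "(b - a) / real (Suc n) < \<delta>"
      using \<open>\<delta> > 0\<close> by (simp add: pos_divide_less_eq mult.commute)
    then show thesis by (rule that[rotated]) simp
  qed
  define x where "x = (b - a) / real n"
  define t where "t i = a + real i * x" for i :: nat
  have "t n = b" using n by (simp add: t_def x_def)
  have step: "t i \<le> t (Suc i)" "t (Suc i) - t i < \<delta>" for i
  proof -
    have "t (Suc i) - t i = x" by (simp add: t_def distrib_right)
    moreover have "0 \<le> x" using \<open>a \<le> b\<close> by (simp add: x_def)
    moreover have "x < \<delta>" using n(2) by (simp add: x_def)
    ultimately show "t i \<le> t (Suc i)" "t (Suc i) - t i < \<delta>" by linarith+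
  qed
  have tmono: "t i \<le> t j" if "i \<le> j" for i j
    using lift_Suc_mono_le[of t, OF step(1) that] .
  have "Z a \<le> Z (t i)" if "i \<le> n" for i
    using that
  proof (induction i)
    case (Suc i)
    have "Z (t i) \<le> Z (t (Suc i))"
      using tmono[of 0 i] tmono[OF Suc.prems] \<open>t n = b\<close> step by (intro loc) (auto simp: t_def)
    with Suc show ?case by simp
  qed (simp add: t_def)
  from this[of n] \<open>t n = b\<close> show ?thesis by simp
qed

text \<open>The integral form of u'' = - h with w = u'. The condition u'(0) = 0 is built in through
  \<open>w_eq\<close>, whereas u(0) = u(T) is assumed only where it is used.\<close>

locale trajectory =
  fixes T :: real and h w u g :: "real \<Rightarrow> real"
  assumes T_pos: "T > 0"
    and h_integrable: "h integrable_on {0..T}"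
    and g_integrable: "g integrable_on {0..T}"
    and h_bound: "\<And>t. t \<in> {0..T} \<Longrightarrow> \<bar>h t\<bar> \<le> g t"
    and w_eq: "\<And>t. t \<in> {0..T} \<Longrightarrow> w t = - integral {0..t} h"
    and u_deriv: "\<And>t. t \<in> {0..T} \<Longrightarrow> (u has_real_derivative w t) (at t within {0..T})"
begin

lemma abs_h_integrable: "(\<lambda>t. \<bar>h t\<bar>) integrable_on {0..T}"
proof -
  have "h absolutely_integrable_on {0..T}"
    using h_bound by (intro absolutely_integrable_integrable_bound[OF _ h_integrable g_integrable]) auto
  then have "(\<lambda>t. norm (h t)) integrable_on {0..T}"
    unfolding absolutely_integrable_on_def by blast
  then show ?thesis by simp
qed

lemma w_0: "w 0 = 0"
  using w_eq[of 0] T_pos by simp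

lemma w_diff:
  assumes "0 \<le> s" "s \<le> t" "t \<le> T"
  shows "w t - w s = - integral {s..t} h"
  using Henstock_Kurzweil_Integration.integral_combine[of 0 s t h] assms w_eq
    integrable_on_subinterval[OF h_integrable, of 0 t] by auto

lemma w_cont: "continuous_on {0..T} w"
proof -
  have "continuous_on {0..T} (\<lambda>t. - integral {0..t} h)"
    by (intro continuous_intros indefinite_integral_continuous_1 h_integrable)
  then show ?thesis using w_eq continuous_on_cong by (metis (no_types, lifting))
qed

lemma u_cont: "continuous_on {0..T} u"
  using u_deriv by (meson DERIV_continuous continuous_on_eq_continuous_within)

lemma u_has_integral:
  assumes "0 \<le> s" "s \<le> t" "t \<le> T"
  shows "(w has_integral u t - u s) {s..t}"
proof (rule fundamental_theorem_of_calculus[OF assms(2)])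
  fix x assume "x \<in> {s..t}"
  then show "(u has_vector_derivative w x) (at x within {s..t})"
    using assms u_deriv[of x] DERIV_subset[of u "w x" x "{0..T}" "{s..t}"]
    by (simp add: has_real_derivative_iff_has_vector_derivative)
qed

lemma abs_w_diff:
  assumes "0 \<le> s" "s \<le> t" "t \<le> T"
  shows "\<bar>w t - w s\<bar> \<le> integral {s..t} (\<lambda>t. \<bar>h t\<bar>)"
proof -
  have "norm (integral {s..t} h) \<le> integral {s..t} (\<lambda>t. \<bar>h t\<bar>)"
    using assms
    by (intro integral_norm_bound_integral integrable_on_subinterval[OF h_integrable]
        integrable_on_subinterval[OF abs_h_integrable]) auto
  then show ?thesis using w_diff[OF assms] by simp
qed

lemma mean_value:
  assumes "0 \<le> s" "s < t" "t \<le> T"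
  shows "\<exists>\<xi>\<in>{s<..<t}. u t - u s = (t - s) * w \<xi>"
proof -
  have "\<exists>\<xi>\<in>{s<..<t}. u t - u s = (\<lambda>x. x * w \<xi>) (t - s)"
  proof (rule mvt_simple[OF assms(2)])
    fix x assume "s \<le> x" "x \<le> t"
    then have "(u has_real_derivative w x) (at x within {s..t})"
      using assms by (intro DERIV_subset[OF u_deriv]) auto
    then show "(u has_derivative (\<lambda>y. y * w x)) (at x within {s..t})"
      by (simp add: has_field_derivative_def mult.commute[of _ "w x"])
  qed
  then show ?thesis by simp
qed

text \<open>Lebesgue differentiation of the integral of h yields the second derivative almost
  everywhere, and |h| as a density yields the absolute continuity of w.\<close>

theorem bvp_solutionI:
  assumes eq: "AE t in lebesgue_on {0..T}. h t = F t (u t) (w t)" and "u 0 = u T"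
  shows "bvp_solution T F u"
proof -
  have "AE t in lebesgue_on {0..T}.
      ((\<lambda>x. integral {0..x} h) has_real_derivative h t) (at t within {0..T})"
    by (rule indefinite_integral_has_real_derivative_AE[OF h_integrable])
  then have "AE t in lebesgue_on {0..T}. t \<in> {0..T} \<and>
      ((\<lambda>x. integral {0..x} h) has_real_derivative h t) (at t within {0..T})"
    using AE_space by eventually_elim auto
  then have der: "AE t in lebesgue_on {0..T}. (w has_real_derivative - h t) (at t within {0..T})"
  proof eventually_elim
    case (elim t)
    then have "((\<lambda>x. - integral {0..x} h) has_real_derivative - h t) (at t within {0..T})"
      by (intro DERIV_minus) auto
    then show ?case
      by (rule has_field_derivative_transform_within[OF _ zero_less_one]) (use elim w_eq in auto)
  qed
  have "absolutely_continuous_on_interval 0 T w"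
  proof (rule absolutely_continuous_on_interval_integral[OF abs_h_integrable])
    show "\<bar>w t - w s\<bar> \<le> integral {s..t} (\<lambda>t. \<bar>h t\<bar>)" if "0 \<le> s" "s \<le> t" "t \<le> T" for s t
      using abs_w_diff[OF that] .
  qed auto
  moreover have "AE t in lebesgue_on {0..T}.
      (w has_real_derivative - h t) (at t within {0..T}) \<and> - h t + F t (u t) (w t) = 0"
    using der eq by eventually_elim simp
  ultimately show ?thesis
    unfolding bvp_solution_def
    using u_deriv w_cont \<open>u 0 = u T\<close> w_0 by (intro exI[of _ w] exI[of _ "\<lambda>t. - h t"]) auto
qed

text \<open>At an interior minimum this is Fermat's criterion; at t0 = 0 it is the condition u'(0) =
  0. Only T is left out, and there u(0) = u(T) will help.\<close>

lemma derivative_zero_at_min: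
  assumes t0: "0 \<le> t0" "t0 < T" and min: "\<And>s. s \<in> {0..T} \<Longrightarrow> u t0 \<le> u s"
  shows "w t0 = 0"
proof (cases "t0 = 0")
  case False
  then have t0': "t0 \<in> {0<..<T}" using t0 by simp
  then have "(u has_real_derivative w t0) (at t0)"
    using u_deriv[of t0] at_within_interior[of t0 "{0..T}"] by simp
  moreover have "u t0 \<le> u y" if "\<bar>t0 - y\<bar> < min t0 (T - t0)" for y
    using that by (intro min) (simp add: abs_less_iff)
  ultimately show ?thesis
    using DERIV_local_min[of u "w t0" t0 "min t0 (T - t0)"] t0' by auto
qed (use w_0 in simp)

text \<open>Minimum principle: to the right of a negative minimum h is positive, so w drops below w
  t0 = 0 and u falls below its minimum.\<close>

theorem nonneg_if_restoring:
  assumes periodic: "u 0 = u T" and "\<kappa> > 0"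
    and restoring: "\<And>t. t \<in> {0..T} \<Longrightarrow> u t < 0 \<Longrightarrow> \<kappa> * min 1 (- u t) \<le> h t"
    and t: "t \<in> {0..T}"
  shows "0 \<le> u t"
proof (rule ccontr)
  assume "\<not> 0 \<le> u t"
  obtain t' where t': "t' \<in> {0..T}" "\<And>s. s \<in> {0..T} \<Longrightarrow> u t' \<le> u s"
    using continuous_attains_inf[OF _ _ u_cont] T_pos by auto
  \<comment> \<open>A minimum at T is moved to 0 by periodicity, because the argument needs room to
    the right of the minimum.\<close>
  obtain t0 where t0: "0 \<le> t0" "t0 < T" "\<And>s. s \<in> {0..T} \<Longrightarrow> u t0 \<le> u s"
  proof (cases "t' = T")
    case True
    with t'(2) periodic T_pos show ?thesis by (intro that[of 0]) auto
  next
    case False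
    with t' show ?thesis by (intro that[of t']) auto
  qed
  have neg: "u t0 < 0" using t0(3)[OF t] \<open>\<not> 0 \<le> u t\<close> by simp
  have "w t0 = 0" by (rule derivative_zero_at_min[OF t0])
  obtain d where d: "d > 0" "\<And>s. s \<in> {0..T} \<Longrightarrow> dist s t0 < d \<Longrightarrow> dist (u s) (u t0) < - u t0 / 2"
    using u_cont t0 neg unfolding continuous_on_iff
    by (metis atLeastAtMost_iff half_gt_zero less_eq_real_def neg_0_less_iff_less)
  define t1 where "t1 = min T (t0 + d / 2)"
  have t1: "t0 < t1" "t1 \<le> T" using t0 d(1) by (auto simp: t1_def)
  \<comment> \<open>Up to t1 the function u stays below half of its minimum, which bounds the
    restoring term away from 0.\<close>
  have hpos: "\<kappa> * min 1 (- u t0 / 2) \<le> h s" if "s \<in> {t0..t1}" for s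
  proof -
    have s: "s \<in> {0..T}" using that t0 t1 by auto
    have "dist s t0 < d" using that d(1) by (auto simp: t1_def dist_real_def)
    from d(2)[OF s this] have us: "u s < u t0 / 2" by (auto simp: dist_real_def)
    have "\<kappa> * min 1 (- u t0 / 2) \<le> \<kappa> * min 1 (- u s)"
      using us \<open>\<kappa> > 0\<close> by (intro mult_left_mono) auto
    also have "\<dots> \<le> h s" using restoring[OF s] us neg by simp
    finally show ?thesis .
  qed
  obtain \<xi> where \<xi>: "\<xi> \<in> {t0<..<t1}" "u t1 - u t0 = (t1 - t0) * w \<xi>"
    using mean_value[OF t0(1) t1] by blast
  define \<mu> where "\<mu> = \<kappa> * min 1 (- u t0 / 2)"
  have "integral {t0..\<xi>} (\<lambda>_. \<mu>) \<le> integral {t0..\<xi>} h"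
    using \<xi>(1) t0 t1 hpos unfolding \<mu>_def
    by (intro integral_le integrable_on_subinterval[OF h_integrable]) auto
  moreover have "integral {t0..\<xi>} (\<lambda>_. \<mu>) = (\<xi> - t0) * \<mu>"
    using \<xi>(1) by simp
  moreover have "0 < (\<xi> - t0) * \<mu>"
    unfolding \<mu>_def using \<xi>(1) \<open>\<kappa> > 0\<close> neg by (intro mult_pos_pos) auto
  moreover have "w \<xi> - w t0 = - integral {t0..\<xi>} h"
    using \<xi>(1) t0 t1 by (intro w_diff) auto
  ultimately have "w \<xi> < 0" using \<open>w t0 = 0\<close> by linarith
  then have "u t1 < u t0" using \<xi>(2) t1 by (smt (verit) mult_pos_neg)
  moreover have "u t0 \<le> u t1" using t0(1) t1 by (intro t0(3)) auto
  ultimately show False by simp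
qed

text \<open>A zero of u \<ge> 0 is a minimum, hence a zero of w too. A Gronwall-type estimate and
  connectedness then spread this common zero over the interval. The bound \<open>lin\<close> is
  asked for only while u and |w| are at most \<rho>, as (f_2) offers no more.\<close>

theorem vanishes_or_positive:
  assumes periodic: "u 0 = u T" and u_nonneg: "\<And>t. t \<in> {0..T} \<Longrightarrow> 0 \<le> u t"
    and k: "k integrable_on {0..T}" "\<And>t. t \<in> {0..T} \<Longrightarrow> 0 \<le> k t" and "\<rho> > 0"
    and lin: "\<And>t. t \<in> {0..T} \<Longrightarrow> u t \<le> \<rho> \<Longrightarrow> \<bar>w t\<bar> \<le> \<rho> \<Longrightarrow> \<bar>h t\<bar> \<le> k t * (\<bar>u t\<bar> + \<bar>w t\<bar>)"
  shows "(\<forall>t\<in>{0..T}. u t = 0) \<or> (\<forall>t\<in>{0..T}. 0 < u t)"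
proof (rule ccontr)
  assume contr: "\<not> ?thesis"
  \<comment> \<open>\<open>y\<close> satisfies a linear integral inequality near each of its zeros, so its zero set is open.\<close>
  define y where "y t = \<bar>u t\<bar> + \<bar>w t\<bar>" for t
  have yc: "continuous_on {0..T} y"
    unfolding y_def by (intro continuous_intros u_cont w_cont)
  define Z where "Z = {t \<in> {0..T}. y t = 0}"
  from contr u_nonneg obtain t' where t': "t' \<in> {0..T}" "u t' = 0" by force
  obtain t0 where t0: "0 \<le> t0" "t0 < T" "u t0 = 0"
  proof (cases "t' = T")
    case True
    with t' periodic T_pos show ?thesis by (intro that[of 0]) auto
  next
    case False
    with t' show ?thesis by (intro that[of t']) auto
  qed
  have "w t0 = 0"
    by (rule derivative_zero_at_min[OF t0(1,2)]) (use u_nonneg t0(3) in simp)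
  then have "t0 \<in> Z" using t0 by (simp add: Z_def y_def)
  \<comment> \<open>In the estimate for y = |u| + |w| the summand 1 accounts for |u'| = |w| \<le> y
    and k for |w'| \<le> k * y.\<close>
  have k1: "(\<lambda>t. k t + 1) integrable_on {0..T}"
    by (intro integrable_add k) auto
  define G where "G t = integral {0..t} (\<lambda>t. k t + 1)" for t
  have Gc: "continuous_on {0..T} G"
    unfolding G_def by (rule indefinite_integral_continuous_1[OF k1])
  have G_diff: "integral {s..t} (\<lambda>t. k t + 1) = G t - G s" if "0 \<le> s" "s \<le> t" "t \<le> T" for s t
    using Henstock_Kurzweil_Integration.integral_combine[of 0 s t "\<lambda>t. k t + 1"] that
      integrable_on_subinterval[OF k1, of 0 t] by (auto simp: G_def)
  have small: "\<exists>d>0. \<forall>s\<in>{0..T}. dist s z < d \<longrightarrow> s \<in> Z" if z: "z \<in> Z" for z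
  proof -
    have z': "z \<in> {0..T}" "u z = 0" "w z = 0" "y z = 0" using z by (auto simp: Z_def y_def)
    obtain d1 where d1: "d1 > 0" "\<And>s. s \<in> {0..T} \<Longrightarrow> dist s z < d1 \<Longrightarrow> dist (y s) (y z) < \<rho>"
      using yc z'(1) \<open>\<rho> > 0\<close> unfolding continuous_on_iff by metis
    \<comment> \<open>The constant 1/2 leaves y s \<le> y s / 2 at the maximum point s of y near
      z.\<close>
    obtain d2 where d2: "d2 > 0" "\<And>s. s \<in> {0..T} \<Longrightarrow> dist s z < d2 \<Longrightarrow> dist (G s) (G z) < 1/2"
      using Gc z'(1) unfolding continuous_on_iff by (metis half_gt_zero_iff zero_less_one)
    define d where "d = min d1 d2 / 2"
    define S where "S = {0..T} \<inter> cball z d"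
    have "d > 0" using d1(1) d2(1) by (simp add: d_def)
    have Ssub: "S \<subseteq> {0..T}" and "z \<in> S" and "compact S"
      using z' \<open>d > 0\<close> by (auto simp: S_def intro: compact_Int)
    have dS: "dist s z < d1" "dist s z < d2" if "s \<in> S" for s
      using that d1(1) d2(1) by (auto simp: S_def d_def dist_commute)
    obtain s where s: "s \<in> S" "\<And>t. t \<in> S \<Longrightarrow> y t \<le> y s"
      using continuous_attains_sup[OF \<open>compact S\<close> _ continuous_on_subset[OF yc Ssub]] \<open>z \<in> S\<close> by blast
    have est: "y s \<le> \<bar>G s - G z\<bar> * y s"
    proof -
      define a b where "a = min s z" and "b = max s z"
      have ab: "0 \<le> a" "a \<le> b" "b \<le> T" using s(1) z' Ssub by (auto simp: a_def b_def)
      have abS: "{a..b} \<subseteq> S" using s(1) \<open>z \<in> S\<close>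
        by (auto simp: S_def a_def b_def dist_real_def min_def max_def split: if_splits)
      have hb: "\<bar>w t\<bar> \<le> y s" "\<bar>h t\<bar> \<le> k t * y s" if "t \<in> {a..b}" for t
      proof -
        have tS: "t \<in> S" using that abS by blast
        then have tT: "t \<in> {0..T}" using Ssub by blast
        have "\<bar>u t\<bar> + \<bar>w t\<bar> < \<rho>" using d1(2)[OF tT dS(1)[OF tS]] z' by (simp add: y_def dist_real_def)
        then have "\<bar>h t\<bar> \<le> k t * y t" unfolding y_def by (intro lin[OF tT]) auto
        also have "\<dots> \<le> k t * y s" by (intro mult_left_mono s(2) k(2) tS tT)
        finally show "\<bar>h t\<bar> \<le> k t * y s" .
        show "\<bar>w t\<bar> \<le> y s" using s(2)[OF tS] by (simp add: y_def)
      qed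
      have kint: "k integrable_on {a..b}" and k1int: "(\<lambda>t. k t + 1) integrable_on {a..b}"
        using ab by (auto intro: integrable_on_subinterval[OF k(1)] integrable_on_subinterval[OF k1])
      have "\<bar>u b - u a\<bar> \<le> integral {a..b} (\<lambda>t. 1 * y s)"
      proof -
        have "norm (integral {a..b} w) \<le> integral {a..b} (\<lambda>t. 1 * y s)"
          using hb(1) u_has_integral[OF ab]
          by (intro integral_norm_bound_integral) (auto simp: has_integral_iff)
        then show ?thesis using u_has_integral[OF ab] by (simp add: has_integral_iff)
      qed
      moreover have "\<bar>w b - w a\<bar> \<le> integral {a..b} (\<lambda>t. k t * y s)"
      proof -
        have "norm (integral {a..b} h) \<le> integral {a..b} (\<lambda>t. k t * y s)"
          using hb(2) ab kint
          by (intro integral_norm_bound_integral integrable_on_subinterval[OF h_integrable]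
              integrable_on_mult_left) auto
        then show ?thesis using w_diff[OF ab] by simp
      qed
      moreover have "integral {a..b} (\<lambda>t. k t * y s) + integral {a..b} (\<lambda>t. 1 * y s) =
          integral {a..b} (\<lambda>t. k t * y s + 1 * y s)"
        using kint
        by (intro Henstock_Kurzweil_Integration.integral_add[symmetric] integrable_on_mult_left) auto
      moreover have "integral {a..b} (\<lambda>t. k t * y s + 1 * y s) = (G b - G a) * y s"
      proof -
        have "integral {a..b} (\<lambda>t. k t * y s + 1 * y s) = integral {a..b} (\<lambda>t. (k t + 1) * y s)"
          by (simp only: distrib_right)
        then show ?thesis using G_diff[OF ab] by simp
      qed
      moreover have "\<bar>u b - u a\<bar> + \<bar>w b - w a\<bar> = y s"
        using z' by (auto simp: y_def a_def b_def min_def max_def)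
      moreover have "(G b - G a) * y s \<le> \<bar>G s - G z\<bar> * y s"
        by (intro mult_right_mono) (auto simp: a_def b_def min_def max_def y_def)
      ultimately show ?thesis by linarith
    qed
    have "\<bar>G s - G z\<bar> < 1/2"
      using d2(2)[OF _ dS(2)[OF s(1)]] s(1) Ssub by (auto simp: dist_real_def)
    moreover have "y s \<ge> 0" by (simp add: y_def)
    ultimately have "\<bar>G s - G z\<bar> * y s \<le> 1/2 * y s" by (intro mult_right_mono) auto
    with est \<open>y s \<ge> 0\<close> have "y s = 0" by simp
    have "s' \<in> Z" if "s' \<in> {0..T}" "dist s' z < d" for s'
    proof -
      have "s' \<in> S" using that by (auto simp: S_def dist_commute)
      from s(2)[OF this] \<open>y s = 0\<close> that(1) show ?thesis by (simp add: Z_def y_def)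
    qed
    with \<open>d > 0\<close> show ?thesis by blast
  qed
  have "openin (top_of_set {0..T}) Z"
    unfolding openin_euclidean_subtopology_iff using small by (auto simp: Z_def)
  moreover have "closedin (top_of_set {0..T}) Z"
    unfolding Z_def by (rule continuous_closedin_preimage_constant[OF yc])
  moreover have "connected {0..T}" by simp
  ultimately have "Z = {0..T}"
    using \<open>t0 \<in> Z\<close> connected_clopen by blast
  have "u t = 0" if "t \<in> {0..T}" for t
  proof -
    have "t \<in> Z" using that \<open>Z = {0..T}\<close> by simp
    then have "\<bar>u t\<bar> + \<bar>w t\<bar> = 0" by (simp add: Z_def y_def)
    then show ?thesis by linarith
  qed
  with contr show False by blast
qed

text \<open>This is the substitution x = w t in the integral of q, for a w that is merely absolutely
  continuous. Over a short step the increment is at most the maximum of q there times the integral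
  of |h|; replacing that maximum by q (w \<tau>) costs \<epsilon>. The steps are summed and
  \<epsilon> tends to 0.\<close>

lemma chain_inequality:
  fixes q m :: "real \<Rightarrow> real"
  assumes t12: "0 \<le> t1" "t1 \<le> t2" "t2 \<le> T"
    and q: "continuous_on {a..b} q" "\<And>x. x \<in> {a..b} \<Longrightarrow> 0 \<le> q x"
    and range: "\<And>t. t \<in> {t1..t2} \<Longrightarrow> w t \<in> {a..b}"
    and m: "m integrable_on {t1..t2}" "\<And>t. t \<in> {t1..t2} \<Longrightarrow> q (w t) * \<bar>h t\<bar> \<le> m t"
  shows "integral {a..w t2} q - integral {a..w t1} q \<le> integral {t1..t2} m"
proof -
  define \<Phi> where "\<Phi> x = integral {a..x} q" for x
  have \<Phi>_diff: "\<Phi> y - \<Phi> x = integral {x..y} q" if "a \<le> x" "x \<le> y" "y \<le> b" for x y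
    using Henstock_Kurzweil_Integration.integral_combine[of a x y q] that
      integrable_on_subinterval[OF integrable_continuous_real[OF q(1)], of a y] by (auto simp: \<Phi>_def)
  have hint: "(\<lambda>t. \<bar>h t\<bar>) integrable_on {t1..t2}"
    using t12 by (auto intro: integrable_on_subinterval[OF abs_h_integrable])
  have wc: "continuous_on {t1..t2} w"
    using t12 by (auto intro: continuous_on_subset[OF w_cont])
  have approx: "\<Phi> (w t2) - \<Phi> (w t1) \<le> integral {t1..t2} m + \<epsilon> * integral {t1..t2} (\<lambda>t. \<bar>h t\<bar>)"
    if "\<epsilon> > 0" for \<epsilon>
  proof -
    define M where "M t = m t + \<epsilon> * \<bar>h t\<bar>" for t
    have Mint: "M integrable_on {t1..t2}"
      unfolding M_def by (intro integrable_add m integrable_on_mult_right hint)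
    have "continuous_on {t1..t2} (\<lambda>t. q (w t))"
      using range by (intro continuous_on_compose2[OF q(1) wc]) auto
    then have "uniformly_continuous_on {t1..t2} (\<lambda>t. q (w t))"
      by (rule compact_uniformly_continuous) simp
    then obtain \<delta> where \<delta>: "\<delta> > 0" "\<And>s t. s \<in> {t1..t2} \<Longrightarrow> t \<in> {t1..t2} \<Longrightarrow> dist s t < \<delta> \<Longrightarrow>
        dist (q (w s)) (q (w t)) < \<epsilon>"
      using \<open>\<epsilon> > 0\<close> unfolding uniformly_continuous_on_def by (metis dist_commute)
    define Z where "Z t = integral {t1..t} M - \<Phi> (w t)" for t
    have "Z t1 \<le> Z t2"
    proof (rule mono_from_uniform_local[OF t12(2) \<delta>(1)])
      fix s t assume st: "t1 \<le> s" "s \<le> t" "t \<le> t2" "t - s < \<delta>"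
      have sub: "{s..t} \<subseteq> {t1..t2}" using st by auto
      have Mst: "M integrable_on {s..t}" by (rule integrable_on_subinterval[OF Mint sub])
      have Mq: "(q (w \<tau>) + \<epsilon>) * \<bar>h \<tau>\<bar> \<le> M \<tau>" if "\<tau> \<in> {s..t}" for \<tau>
        using m(2)[of \<tau>] that sub by (auto simp: M_def distrib_right)
      have "\<Phi> (w t) - \<Phi> (w s) \<le> integral {s..t} M"
      proof (cases "w s \<le> w t")
        case False
        have "\<Phi> (w s) - \<Phi> (w t) = integral {w t..w s} q"
          using False range[of s] range[of t] st by (intro \<Phi>_diff) auto
        also have "\<dots> \<ge> 0"
          using range[of s] range[of t] st q(2)
          by (intro integral_nonneg integrable_on_subinterval[OF integrable_continuous_real[OF q(1)]]) auto
        finally have "\<Phi> (w t) - \<Phi> (w s) \<le> 0" by simp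
        also have "0 \<le> integral {s..t} M"
        proof (rule integral_nonneg[OF Mst])
          fix \<tau> assume \<tau>: "\<tau> \<in> {s..t}"
          then have "0 \<le> (q (w \<tau>) + \<epsilon>) * \<bar>h \<tau>\<bar>"
            using q(2)[OF range, of \<tau>] sub \<open>\<epsilon> > 0\<close> by (intro mult_nonneg_nonneg) auto
          with Mq[OF \<tau>] show "0 \<le> M \<tau>" by simp
        qed
        finally show ?thesis .
      next
        case True
        have wsub: "{w s..w t} \<subseteq> {a..b}" using range[of s] range[of t] st by auto
        have qi: "q integrable_on {w s..w t}"
          by (rule integrable_on_subinterval[OF integrable_continuous_real[OF q(1)] wsub])
        obtain \<zeta> where \<zeta>: "\<zeta> \<in> {w s..w t}" "\<And>x. x \<in> {w s..w t} \<Longrightarrow> q x \<le> q \<zeta>"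
          using continuous_attains_sup[of "{w s..w t}" q] continuous_on_subset[OF q(1) wsub] True by auto
        \<comment> \<open>The maximum of q over the range is attained along the trajectory within
          the same step, so the uniform continuity of q composed with w applies to it.\<close>
        obtain \<tau>' where \<tau>': "s \<le> \<tau>'" "\<tau>' \<le> t" "w \<tau>' = \<zeta>"
          using IVT'[of w s \<zeta> t] \<zeta>(1) st continuous_on_subset[OF wc sub] by auto
        have "\<Phi> (w t) - \<Phi> (w s) = integral {w s..w t} q"
          using True range[of s] range[of t] st by (intro \<Phi>_diff) auto
        also have "\<dots> \<le> integral {w s..w t} (\<lambda>_. q \<zeta>)"
          using \<zeta>(2) by (intro integral_le qi) auto
        also have "\<dots> = q \<zeta> * (w t - w s)" using True by simp
        also have "\<dots> \<le> q \<zeta> * integral {s..t} (\<lambda>t. \<bar>h t\<bar>)"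
          using abs_w_diff[of s t] st t12 q(2) \<zeta>(1) wsub by (intro mult_left_mono) auto
        also have "\<dots> = integral {s..t} (\<lambda>t. q \<zeta> * \<bar>h t\<bar>)" by simp
        also have "\<dots> \<le> integral {s..t} M"
        proof (rule integral_le[OF integrable_on_mult_right[OF integrable_on_subinterval[OF hint sub]] Mst])
          fix \<tau> assume \<tau>: "\<tau> \<in> {s..t}"
          have "dist (q (w \<tau>')) (q (w \<tau>)) < \<epsilon>"
            using \<tau> \<tau>' st sub by (intro \<delta>(2)) (auto simp: dist_real_def)
          then have "q \<zeta> \<le> q (w \<tau>) + \<epsilon>" using \<tau>'(3) by (simp add: dist_real_def)
          then have "q \<zeta> * \<bar>h \<tau>\<bar> \<le> (q (w \<tau>) + \<epsilon>) * \<bar>h \<tau>\<bar>" by (intro mult_right_mono) auto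
          with Mq[OF \<tau>] show "q \<zeta> * \<bar>h \<tau>\<bar> \<le> M \<tau>" by simp
        qed
        finally show ?thesis .
      qed
      moreover have "integral {t1..t} M = integral {t1..s} M + integral {s..t} M"
        using st Henstock_Kurzweil_Integration.integral_combine[of t1 s t M]
          integrable_on_subinterval[OF Mint, of t1 t] by auto
      ultimately show "Z s \<le> Z t" by (simp add: Z_def)
    qed
    moreover have "integral {t1..t2} M = integral {t1..t2} m + \<epsilon> * integral {t1..t2} (\<lambda>t. \<bar>h t\<bar>)"
      unfolding M_def
      using Henstock_Kurzweil_Integration.integral_add[OF m(1) integrable_on_mult_right[OF hint, of \<epsilon>]]
      by simp
    ultimately show ?thesis by (simp add: Z_def)
  qed
  have "((\<lambda>\<epsilon>. integral {t1..t2} m + \<epsilon> * integral {t1..t2} (\<lambda>t. \<bar>h t\<bar>)) \<longlongrightarrow>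
      integral {t1..t2} m + 0 * integral {t1..t2} (\<lambda>t. \<bar>h t\<bar>)) (at_right 0)"
    by (intro tendsto_intros)
  then have "\<Phi> (w t2) - \<Phi> (w t1) \<le> integral {t1..t2} m + 0 * integral {t1..t2} (\<lambda>t. \<bar>h t\<bar>)"
    by (rule tendsto_lowerbound)
       (use approx in \<open>auto simp: eventually_at_filter\<close>)
  then show ?thesis by (simp add: \<Phi>_def)
qed

text \<open>Between the last passage of w through a and the first arrival at M the values of w stay
  in [a, M]. There \<open>chain_inequality\<close> bounds the integral of q by that of m + C * w,
  and since w = u' the last term integrates to C times an increment of u. The choice of M forbids
  this.\<close>

lemma derivative_upper_bound:
  assumes a: "0 < a" "a < M"
    and q: "continuous_on {a..M} q" "\<And>x. x \<in> {a..M} \<Longrightarrow> 0 \<le> q x"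
    and m: "m integrable_on {0..T}" "\<And>t. t \<in> {0..T} \<Longrightarrow> 0 \<le> m t" and "C \<ge> 0"
    and growth: "\<And>t. t \<in> {0..T} \<Longrightarrow> a \<le> w t \<Longrightarrow> w t \<le> M \<Longrightarrow> q (w t) * \<bar>h t\<bar> \<le> m t + C * w t"
    and osc: "\<And>s t. s \<in> {0..T} \<Longrightarrow> t \<in> {0..T} \<Longrightarrow> u t - u s \<le> \<eta>"
    and M: "integral {0..T} m + C * \<eta> < integral {a..M} q"
    and t: "t \<in> {0..T}"
  shows "w t < M"
proof (rule ccontr)
  assume "\<not> w t < M"
  define S where "S = {s \<in> {0..T}. w s = M}"
  have "compact S"
    unfolding S_def using continuous_closedin_preimage_constant[OF w_cont, of M]
    by (metis closedin_compact compact_Icc)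
  moreover have "S \<noteq> {}"
  proof -
    have "\<exists>s\<ge>0. s \<le> t \<and> w s = M"
      by (rule IVT'[OF _ _ _ continuous_on_subset[OF w_cont]])
         (use w_0 a \<open>\<not> w t < M\<close> t in auto)
    then obtain s where "0 \<le> s" "s \<le> t" "w s = M" by blast
    then have "s \<in> S" using t by (simp add: S_def)
    then show ?thesis by blast
  qed
  ultimately obtain t2 where t2: "t2 \<in> S" "\<And>s. s \<in> S \<Longrightarrow> t2 \<le> s"
    using compact_attains_inf[of S] by blast
  have t2': "0 \<le> t2" "t2 \<le> T" "w t2 = M" using t2(1) by (auto simp: S_def)
  define A where "A = {s \<in> {0..t2}. w s = a}"
  have wc2: "continuous_on {0..t2} w"
    using t2' by (auto intro: continuous_on_subset[OF w_cont])
  have "compact A"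
    unfolding A_def using continuous_closedin_preimage_constant[OF wc2, of a]
    by (metis closedin_compact compact_Icc)
  moreover have "A \<noteq> {}"
  proof -
    have "\<exists>s\<ge>0. s \<le> t2 \<and> w s = a"
      by (rule IVT'[OF _ _ _ wc2]) (use w_0 a t2' in auto)
    then show ?thesis by (auto simp: A_def)
  qed
  ultimately obtain t1 where t1: "t1 \<in> A" "\<And>s. s \<in> A \<Longrightarrow> s \<le> t1"
    using compact_attains_sup[of A] by blast
  have t1': "0 \<le> t1" "t1 \<le> t2" "w t1 = a" using t1(1) by (auto simp: A_def)
  have range: "w s \<in> {a..M}" if s: "s \<in> {t1..t2}" for s
  proof -
    have "a \<le> w s"
    proof (rule ccontr)
      assume "\<not> a \<le> w s"
      have "\<exists>x\<ge>s. x \<le> t2 \<and> w x = a"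
        by (rule IVT'[OF _ _ _ continuous_on_subset[OF wc2]])
           (use s a t1' t2' \<open>\<not> a \<le> w s\<close> in auto)
      then obtain x where x: "s \<le> x" "x \<le> t2" "w x = a" by blast
      then have "x \<in> A" using s t1' by (auto simp: A_def)
      from t1(2)[OF this] x s have "s = t1" by simp
      then show False using t1' \<open>\<not> a \<le> w s\<close> by simp
    qed
    moreover have "w s \<le> M"
    proof (rule ccontr)
      assume "\<not> w s \<le> M"
      have "\<exists>x\<ge>0. x \<le> s \<and> w x = M"
        by (rule IVT'[OF _ _ _ continuous_on_subset[OF wc2]])
           (use s a w_0 t1' t2' \<open>\<not> w s \<le> M\<close> in auto)
      then obtain x where x: "0 \<le> x" "x \<le> s" "w x = M" by blast
      then have "x \<in> S" using s t2' by (auto simp: S_def)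
      from t2(2)[OF this] x s have "s = t2" by simp
      then show False using t2' \<open>\<not> w s \<le> M\<close> by simp
    qed
    ultimately show ?thesis by simp
  qed
  have mi: "m integrable_on {t1..t2}"
    using t1' t2' by (auto intro: integrable_on_subinterval[OF m(1)])
  have wi: "(w has_integral u t2 - u t1) {t1..t2}"
    by (rule u_has_integral[OF t1'(1,2) t2'(2)])
  have mw: "((\<lambda>t. m t + C * w t) has_integral integral {t1..t2} m + C * (u t2 - u t1)) {t1..t2}"
    by (intro has_integral_add integrable_integral mi has_integral_mult_right wi)
  have "integral {a..w t2} q - integral {a..w t1} q \<le> integral {t1..t2} (\<lambda>t. m t + C * w t)"
    using mw growth range t1' t2' by (intro chain_inequality[OF _ _ _ q]) (auto simp: has_integral_iff)
  also have "\<dots> = integral {t1..t2} m + C * (u t2 - u t1)"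
    using mw by (rule integral_unique)
  also have "\<dots> \<le> integral {0..T} m + C * \<eta>"
    using t1' t2' m \<open>C \<ge> 0\<close>
    by (intro add_mono integral_subset_le mi mult_left_mono osc) auto
  finally show False using M t1' t2' by simp
qed

end

theorem (in trajectory) derivative_bound:
  assumes a: "0 < a" "a < M"
    and q: "continuous_on {a..M} q" "\<And>x. x \<in> {a..M} \<Longrightarrow> 0 \<le> q x"
    and m: "m integrable_on {0..T}" "\<And>t. t \<in> {0..T} \<Longrightarrow> 0 \<le> m t" and "C \<ge> 0"
    and growth: "\<And>t. t \<in> {0..T} \<Longrightarrow> a \<le> \<bar>w t\<bar> \<Longrightarrow> \<bar>w t\<bar> \<le> M \<Longrightarrow>
        q \<bar>w t\<bar> * \<bar>h t\<bar> \<le> m t + C * \<bar>w t\<bar>"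
    and u: "\<And>t. t \<in> {0..T} \<Longrightarrow> 0 \<le> u t \<and> u t \<le> \<eta>"
    and M: "integral {0..T} m + C * \<eta> < integral {a..M} q"
    and t: "t \<in> {0..T}"
  shows "\<bar>w t\<bar> < M"
proof -
  \<comment> \<open>The lower bound comes from -u. The one-sided estimate assumes an oscillation
    bound rather than 0 \<le> u \<le> \<eta> because only the former survives this change of
    sign.\<close>
  interpret neg: trajectory T "\<lambda>t. - h t" "\<lambda>t. - w t" "\<lambda>t. - u t" g
  proof
    show "(\<lambda>t. - h t) integrable_on {0..T}" using h_integrable by (rule integrable_neg)
    show "- w t = - integral {0..t} (\<lambda>t. - h t)" if "t \<in> {0..T}" for t
      using w_eq[OF that] by simp
    show "((\<lambda>t. - u t) has_real_derivative - w t) (at t within {0..T})" if "t \<in> {0..T}" for t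
      by (rule DERIV_minus[OF u_deriv[OF that]])
  qed (use T_pos g_integrable h_bound in auto)
  have "w t < M"
  proof (rule derivative_upper_bound[OF a q m \<open>C \<ge> 0\<close> _ _ M t])
    show "q (w t) * \<bar>h t\<bar> \<le> m t + C * w t" if "t \<in> {0..T}" "a \<le> w t" "w t \<le> M" for t
      using growth[of t] that a by simp
    show "u t - u s \<le> \<eta>" if "s \<in> {0..T}" "t \<in> {0..T}" for s t
      using u[OF that(1)] u[OF that(2)] by simp
  qed
  moreover have "- w t < M"
  proof (rule neg.derivative_upper_bound[OF a q m \<open>C \<ge> 0\<close> _ _ M t])
    show "q (- w t) * \<bar>- h t\<bar> \<le> m t + C * - w t" if "t \<in> {0..T}" "a \<le> - w t" "- w t \<le> M" for t
      using growth[of t] that a by simp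
    show "- u t - - u s \<le> \<eta>" if "s \<in> {0..T}" "t \<in> {0..T}" for s t
      using u[OF that(1)] u[OF that(2)] by simp
  qed
  ultimately show ?thesis by simp
qed

subsection \<open>The shooting map\<close>

lemma continuous_on_Max_image:
  fixes f :: "'i \<Rightarrow> 'a::topological_space \<Rightarrow> real"
  assumes "finite I" "I \<noteq> {}" "\<And>i. i \<in> I \<Longrightarrow> continuous_on S (f i)"
  shows "continuous_on S (\<lambda>x. Max ((\<lambda>i. f i x) ` I))"
  using assms
proof (induction I rule: finite_ne_induct)
  case (insert j J)
  then have "continuous_on S (\<lambda>x. max (f j x) (Max ((\<lambda>i. f i x) ` J)))"
    by (intro continuous_intros) auto
  with insert show ?case by simp
qed simp

text \<open>Here F is already truncated and defined for all s and \<xi>, and its properties hold at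
  every t; the exceptional null set is removed when the locale is interpreted.\<close>

locale shooting =
  fixes T \<alpha>\<^sub>0 :: real and F :: "real \<Rightarrow> real \<Rightarrow> real \<Rightarrow> real" and v g :: "real \<Rightarrow> real"
  assumes T_pos: "T > 0" and \<alpha>\<^sub>0_pos: "\<alpha>\<^sub>0 > 0"
    and F_integrable: "\<And>s \<xi>. (\<lambda>t. F t s \<xi>) integrable_on {0..T}"
    and F_bound: "\<And>t s \<xi>. t \<in> {0..T} \<Longrightarrow> \<bar>F t s \<xi>\<bar> \<le> g t"
    and F_cont: "\<And>t. t \<in> {0..T} \<Longrightarrow> continuous_on UNIV (\<lambda>(s, \<xi>). F t s \<xi>)"
    and g_integrable: "g integrable_on {0..T}"
    and v_integrable: "v integrable_on {0..T}"
    and v_nonneg: "\<And>t. t \<in> {0..T} \<Longrightarrow> 0 \<le> v t"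
begin

definition majorant :: "real \<Rightarrow> real" where
  "majorant t = g t + \<alpha>\<^sub>0 * v t"

text \<open>The factor \<theta> stands in front of the forcing as well. In the homotopy \<theta> = 1
  or \<alpha> = 0 always holds, so this agrees with both families of problems.\<close>

definition periodic_trajectory :: "real \<Rightarrow> real \<Rightarrow> (real \<Rightarrow> real) \<Rightarrow> (real \<Rightarrow> real) \<Rightarrow> bool" where
  "periodic_trajectory \<theta> \<alpha> u w \<longleftrightarrow>
     trajectory T (\<lambda>t. \<theta> * (F t (u t) (w t) + \<alpha> * v t)) w u majorant \<and> u 0 = u T"

definition scale :: "real \<Rightarrow> real" where
  "scale \<sigma> = max 0 (min 1 \<sigma>)"

definition forcing :: "real \<Rightarrow> real" where
  "forcing \<sigma> = \<alpha>\<^sub>0 * max 0 (min 1 (\<sigma> - 1))"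

definition bound :: real where
  "bound = integral {0..T} majorant"

text \<open>\<open>I\<close> is the integral of the right-hand side and \<open>J\<close> that of \<open>I\<close>; the trajectory is \<open>u = c - \<theta> * J\<close> with
  derivative \<open>- \<theta> * I\<close>. Keeping \<open>\<theta>\<close> out of the state makes \<open>J T = 0\<close> a meaningful shooting condition
  even at \<open>\<theta> = 0\<close>. The parameter \<open>\<sigma>\<close> raises \<open>\<theta>\<close> to 1 on \<open>[0,1]\<close> and the forcing to \<open>\<alpha>\<^sub>0\<close> on \<open>[1,2]\<close>.
  Truncating \<open>I\<close> at its a priori bound makes the field dominated.\<close>

definition field :: "real \<Rightarrow> real \<times> real \<Rightarrow> real \<times> real \<Rightarrow> real \<times> real" where
  "field t = (\<lambda>(c, \<sigma>) (I, J).
     (F t (c - scale \<sigma> * J) (- (scale \<sigma> * I)) + forcing \<sigma> * v t, max (- bound) (min bound I)))"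

lemma scale_range: "0 \<le> scale \<sigma>" "scale \<sigma> \<le> 1"
  by (auto simp: scale_def)

lemma forcing_range: "0 \<le> forcing \<sigma>" "forcing \<sigma> \<le> \<alpha>\<^sub>0"
  using \<alpha>\<^sub>0_pos by (auto simp: forcing_def)

lemma g_nonneg: "t \<in> {0..T} \<Longrightarrow> 0 \<le> g t"
  using F_bound[of t 0 0] by linarith

lemma majorant_nonneg: "t \<in> {0..T} \<Longrightarrow> 0 \<le> majorant t"
  using g_nonneg v_nonneg \<alpha>\<^sub>0_pos by (simp add: majorant_def)

lemma majorant_integrable: "majorant integrable_on {0..T}"
  unfolding majorant_def by (intro integrable_add g_integrable integrable_on_mult_right v_integrable)

lemma bound_nonneg: "0 \<le> bound"
  unfolding bound_def using majorant_nonneg by (intro integral_nonneg majorant_integrable) auto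

lemma rhs_bound:
  assumes "t \<in> {0..T}" "0 \<le> \<alpha>" "\<alpha> \<le> \<alpha>\<^sub>0"
  shows "\<bar>F t s \<xi> + \<alpha> * v t\<bar> \<le> majorant t"
proof -
  have "\<bar>\<alpha> * v t\<bar> \<le> \<alpha>\<^sub>0 * v t"
    using assms v_nonneg by (simp add: abs_mult mult_right_mono)
  then show ?thesis
    unfolding majorant_def using F_bound[OF assms(1), of s \<xi>] by linarith
qed

sublocale sys: caratheodory_system T field "\<lambda>t. majorant t + bound"
proof
  show "T > 0" by (rule T_pos)
  show "(\<lambda>t. majorant t + bound) integrable_on {0..T}"
    by (intro integrable_add majorant_integrable) auto
  fix p y :: "real \<times> real"
  obtain c \<sigma> I J where p: "p = (c, \<sigma>)" and y: "y = (I, J)" by fastforce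
  have "(\<lambda>t. (F t (c - scale \<sigma> * J) (- (scale \<sigma> * I)) + forcing \<sigma> * v t) *\<^sub>R (1::real, 0::real) +
      (0, max (- bound) (min bound I))) integrable_on {0..T}"
    by (intro integrable_add integrable_on_scaleR_left F_integrable integrable_on_mult_right
        v_integrable integrable_const_ivl)
  then show "(\<lambda>t. field t p y) integrable_on {0..T}"
    by (simp add: field_def p y)
  fix t assume t: "t \<in> {0..T}"
  have "\<bar>max (- b) (min b I)\<bar> \<le> b" if "0 \<le> b" for b :: real
    using that by (simp add: abs_le_iff)
  from this[OF bound_nonneg] have "\<bar>max (- bound) (min bound I)\<bar> \<le> bound" .
  then have "\<bar>F t (c - scale \<sigma> * J) (- (scale \<sigma> * I)) + forcing \<sigma> * v t\<bar> +
      \<bar>max (- bound) (min bound I)\<bar> \<le> majorant t + bound"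
    by (intro add_mono rhs_bound[OF t forcing_range])
  moreover have "norm (field t p y) \<le>
      \<bar>F t (c - scale \<sigma> * J) (- (scale \<sigma> * I)) + forcing \<sigma> * v t\<bar> +
      \<bar>max (- bound) (min bound I)\<bar>"
    unfolding field_def p y prod.case
    by (rule order_trans[OF norm_Pair_le]) simp
  ultimately show "norm (field t p y) \<le> majorant t + bound" by linarith
next
  fix t assume t: "t \<in> {0..T}"
  have F: "continuous_on UNIV (\<lambda>z. F t (fst z) (snd z))"
    using F_cont[OF t] by (simp add: case_prod_unfold)
  define a where "a z = (fst (fst z) - scale (snd (fst z)) * snd (snd z),
      - (scale (snd (fst z)) * fst (snd z)))" for z :: "(real \<times> real) \<times> real \<times> real"
  have a: "continuous_on UNIV a"
    unfolding a_def scale_def by (intro continuous_intros)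
  have "continuous_on UNIV (\<lambda>z. F t (fst (a z)) (snd (a z)))"
    by (rule continuous_on_compose2[OF F a]) simp
  then have "continuous_on UNIV (\<lambda>z. (F t (fst (a z)) (snd (a z)) + forcing (snd (fst z)) * v t,
      max (- bound) (min bound (fst (snd z)))))"
    unfolding forcing_def by (intro continuous_intros)
  then show "continuous_on UNIV (\<lambda>(p, y). field t p y)"
    by (simp add: field_def case_prod_unfold a_def)
qed

text \<open>Along a solution |I| is at most the integral of \<open>majorant\<close>, so the
  truncation of I in \<open>field\<close> is inactive. Hence J' = I, and u and w satisfy the
  original second order equation.\<close>

lemma system_solution:
  assumes sol: "sys.solution (c, \<sigma>) Y" and \<sigma>: "0 \<le> \<sigma>" "\<sigma> \<le> 1 \<or> scale \<sigma> = 1"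
  defines "u \<equiv> \<lambda>t. c - scale \<sigma> * snd (Y t)" and "w \<equiv> \<lambda>t. - (scale \<sigma> * fst (Y t))"
  shows "trajectory T (\<lambda>t. scale \<sigma> * (F t (u t) (w t) + forcing \<sigma> * v t)) w u majorant"
    and "t \<in> {0..T} \<Longrightarrow>
      ((\<lambda>t. F t (u t) (w t) + forcing \<sigma> * v t) has_integral fst (Y t)) {0..t}"
    and "t \<in> {0..T} \<Longrightarrow> ((\<lambda>t. fst (Y t)) has_integral snd (Y t)) {0..t}"
proof -
  define k where "k t = F t (u t) (w t) + forcing \<sigma> * v t" for t
  have Yint: "((\<lambda>s. field s (c, \<sigma>) (Y s)) has_integral Y t) {0..t}" if "t \<in> {0..T}" for t
    using sol that by (auto simp: sys.solution_def)
  have Ycont: "continuous_on {0..T} Y"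
    using sol by (simp add: sys.solution_def)
  have I: "(k has_integral fst (Y t)) {0..t}" if "t \<in> {0..T}" for t
    using has_integral_linear[OF Yint[OF that] bounded_linear_fst]
    by (simp add: comp_def field_def case_prod_unfold u_def w_def k_def[abs_def])
  have kb: "\<bar>k t\<bar> \<le> majorant t" if "t \<in> {0..T}" for t
    unfolding k_def by (rule rhs_bound[OF that forcing_range])
  have Ib: "\<bar>fst (Y t)\<bar> \<le> bound" if t: "t \<in> {0..T}" for t
  proof -
    have sub: "{0..t} \<subseteq> {0..T}" using t by auto
    have "norm (integral {0..t} k) \<le> integral {0..t} majorant"
      using I[OF t] kb sub
      by (intro integral_norm_bound_integral integrable_on_subinterval[OF majorant_integrable sub])
         (auto simp: has_integral_iff)
    also have "\<dots> \<le> bound"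
      unfolding bound_def using majorant_nonneg sub
      by (intro integral_subset_le integrable_on_subinterval[OF majorant_integrable sub] majorant_integrable) auto
    finally show ?thesis using I[OF t] by (simp add: has_integral_iff)
  qed
  have J: "((\<lambda>t. fst (Y t)) has_integral snd (Y t)) {0..t}" if t: "t \<in> {0..T}" for t
  proof (rule has_integral_eq)
    show "((\<lambda>s. max (- bound) (min bound (fst (Y s)))) has_integral snd (Y t)) {0..t}"
      using has_integral_linear[OF Yint[OF t] bounded_linear_snd]
      by (simp add: comp_def field_def case_prod_unfold)
    show "max (- bound) (min bound (fst (Y s))) = fst (Y s)" if "s \<in> {0..t}" for s
      using Ib[of s] that t by auto
  qed
  show "((\<lambda>t. F t (u t) (w t) + forcing \<sigma> * v t) has_integral fst (Y t)) {0..t}"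
    if "t \<in> {0..T}" using I[OF that] unfolding k_def .
  show "((\<lambda>t. fst (Y t)) has_integral snd (Y t)) {0..t}" if "t \<in> {0..T}"
    using J[OF that] .
  have kint: "k integrable_on {0..T}"
    using I[of T] T_pos by (auto simp: has_integral_iff)
  have "trajectory T (\<lambda>t. scale \<sigma> * k t) w u majorant"
  proof
    show "T > 0" by (rule T_pos)
    show "(\<lambda>t. scale \<sigma> * k t) integrable_on {0..T}"
      by (rule integrable_on_mult_right[OF kint])
    show "majorant integrable_on {0..T}" by (rule majorant_integrable)
    fix t assume t: "t \<in> {0..T}"
    have "\<bar>scale \<sigma> * k t\<bar> \<le> 1 * \<bar>k t\<bar>"
      unfolding abs_mult using scale_range[of \<sigma>] by (intro mult_right_mono) auto
    with kb[OF t] show "\<bar>scale \<sigma> * k t\<bar> \<le> majorant t" by simp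
    show "w t = - integral {0..t} (\<lambda>t. scale \<sigma> * k t)"
      using I[OF t] by (simp add: w_def has_integral_iff)
    have "((\<lambda>x. integral {0..x} (\<lambda>t. fst (Y t))) has_real_derivative fst (Y t)) (at t within {0..T})"
      by (rule integral_has_real_derivative[OF _ t]) (intro continuous_intros Ycont)
    then have "((\<lambda>x. c - scale \<sigma> * integral {0..x} (\<lambda>t. fst (Y t))) has_real_derivative
        0 - scale \<sigma> * fst (Y t)) (at t within {0..T})"
      by (intro DERIV_diff DERIV_const DERIV_cmult)
    then have "(u has_real_derivative 0 - scale \<sigma> * fst (Y t)) (at t within {0..T})"
      by (rule has_field_derivative_transform_within[OF _ zero_less_one t])
         (use J in \<open>auto simp: u_def has_integral_iff\<close>)
    then show "(u has_real_derivative w t) (at t within {0..T})" by (simp add: w_def)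
  qed
  then show "trajectory T (\<lambda>t. scale \<sigma> * (F t (u t) (w t) + forcing \<sigma> * v t)) w u majorant"
    by (simp add: k_def)
qed

text \<open>Without a periodic trajectory in the open annulus, \<open>at_r\<close> and
  \<open>at_R\<close> rule out the closed one as well at \<theta> = 1, \<alpha> = 0. Exact solutions
  then avoid a closed set, a fine Euler scheme avoids it with a margin, and
  \<open>no_degree_jump\<close> is contradicted.\<close>

theorem annulus_solution:
  assumes r: "r > 0"
    and right: "integral {0..T} (\<lambda>s. integral {0..s} (\<lambda>t. F t r 0)) < 0"
    and left: "0 < integral {0..T} (\<lambda>s. integral {0..s} (\<lambda>t. F t (-r) 0))"
    and at_r: "\<And>\<theta> u w. 0 < \<theta> \<Longrightarrow> \<theta> \<le> 1 \<Longrightarrow> periodic_trajectory \<theta> 0 u w \<Longrightarrow> sup_norm_on T u \<noteq> r"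
    and at_R: "\<And>\<alpha> u w. 0 \<le> \<alpha> \<Longrightarrow> \<alpha> \<le> \<alpha>\<^sub>0 \<Longrightarrow> periodic_trajectory 1 \<alpha> u w \<Longrightarrow> sup_norm_on T u \<noteq> R"
    and none: "\<And>u w. periodic_trajectory 1 \<alpha>\<^sub>0 u w \<Longrightarrow> \<not> sup_norm_on T u \<le> R"
  shows "\<exists>u w. periodic_trajectory 1 0 u w \<and> min r R < sup_norm_on T u \<and> sup_norm_on T u < max r R"
proof (rule ccontr)
  assume contr: "\<not> ?thesis"
  define \<nu> :: "real \<times> real \<Rightarrow> real \<times> real \<Rightarrow> real"
    where "\<nu> p y = \<bar>fst p - scale (snd p) * snd y\<bar>" for p y
  define L where "L = max r R + 1"
  define K where "K = {-L..L} \<times> {0..2::real}"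
  \<comment> \<open>The configurations that the degree argument has to exclude.\<close>
  define C :: "((real \<times> real) \<times> real \<times> (real \<times> real)) set" where
    "C = {z. (snd (snd (snd z)) = 0 \<and>
            (snd (fst z) \<le> 1 \<and> fst (snd z) = r \<or>
             snd (fst z) = 1 \<and> min r R \<le> fst (snd z) \<and> fst (snd z) \<le> max r R \<or>
             1 \<le> snd (fst z) \<and> fst (snd z) = R \<or>
             snd (fst z) = 2 \<and> fst (snd z) \<le> R)) \<or>
          snd (fst z) = 0 \<and> fst (fst z) = r \<and> 0 \<le> snd (snd (snd z)) \<or>
          snd (fst z) = 0 \<and> fst (fst z) = - r \<and> snd (snd (snd z)) \<le> 0}"
  \<comment> \<open>At \<sigma> = 0 and c = r or c = -r whole half-lines of end values are forbidden
    instead of the zero alone: the margin then yields signs and not just absolute values.\<close>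
  have C_iff: "((c, \<sigma>), x, y) \<in> C \<longleftrightarrow>
      snd y = 0 \<and> (\<sigma> \<le> 1 \<and> x = r \<or> \<sigma> = 1 \<and> min r R \<le> x \<and> x \<le> max r R \<or>
        1 \<le> \<sigma> \<and> x = R \<or> \<sigma> = 2 \<and> x \<le> R) \<or>
      \<sigma> = 0 \<and> c = r \<and> 0 \<le> snd y \<or> \<sigma> = 0 \<and> c = - r \<and> snd y \<le> 0" for c \<sigma> x y
    by (simp add: C_def)
  have "closed C"
    unfolding C_def
    by (intro closed_Collect_disj closed_Collect_conj closed_Collect_le closed_Collect_eq
        continuous_intros)
  have "compact K" unfolding K_def by (intro compact_Times) auto
  have \<nu>_cont: "continuous_on UNIV (\<lambda>(p, y). \<nu> p y)"
    unfolding \<nu>_def scale_def case_prod_unfold by (intro continuous_intros)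
  have avoid: "(p, \<nu> p (Y \<tau>), Y T) \<notin> C"
    if p: "p \<in> K" and sol: "sys.solution p Y" and \<tau>: "\<tau> \<in> {0..T}"
      and max: "\<And>t. t \<in> {0..T} \<Longrightarrow> \<nu> p (Y t) \<le> \<nu> p (Y \<tau>)" for p Y \<tau>
  proof
    obtain c \<sigma> where p': "p = (c, \<sigma>)" by fastforce
    have \<sigma>: "0 \<le> \<sigma>" "\<sigma> \<le> 2" using p by (auto simp: K_def p')
    assume "(p, \<nu> p (Y \<tau>), Y T) \<in> C"
    note inC = this[unfolded p' C_iff]
    define u where "u t = c - scale \<sigma> * snd (Y t)" for t
    define w where "w t = - (scale \<sigma> * fst (Y t))" for t
    have "\<sigma> \<le> 1 \<or> scale \<sigma> = 1" by (auto simp: scale_def)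
    note sys = system_solution[OF sol[unfolded p'] \<sigma>(1) this, folded u_def w_def]
    define x where "x = sup_norm_on T u"
    have x: "\<nu> (c, \<sigma>) (Y \<tau>) = x"
    proof -
      have "sup_norm_on T u = \<nu> (c, \<sigma>) (Y \<tau>)"
        unfolding sup_norm_on_def
        by (rule cSup_eq_maximum) (use max \<tau> in \<open>auto simp: \<nu>_def u_def p'\<close>)
      then show ?thesis by (simp add: x_def)
    qed
    have Y0: "snd (Y 0) = 0"
      using sys(3)[of 0] T_pos by (simp add: has_integral_iff)
    have per: "periodic_trajectory (scale \<sigma>) (forcing \<sigma>) u w" if "snd (Y T) = 0"
    proof -
      have "u 0 = u T" using that Y0 by (simp add: u_def)
      with sys(1) show ?thesis unfolding periodic_trajectory_def by blast
    qed
    \<comment> \<open>At \<theta> = 0 the trajectory is the constant c, and J(T) is the quantity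
      whose sign \<open>right\<close> and \<open>left\<close> prescribe.\<close>
    have zero: "snd (Y T) = integral {0..T} (\<lambda>s. integral {0..s} (\<lambda>t. F t c 0))" "x = \<bar>c\<bar>"
      if "\<sigma> = 0"
    proof -
      have s0: "scale \<sigma> = 0" "forcing \<sigma> = 0" using that by (auto simp: scale_def forcing_def)
      have "snd (Y T) = integral {0..T} (\<lambda>t. fst (Y t))"
        using sys(3)[of T] T_pos by (simp add: has_integral_iff)
      also have "\<dots> = integral {0..T} (\<lambda>s. integral {0..s} (\<lambda>t. F t c 0))"
      proof (rule integral_cong)
        fix s assume "s \<in> {0..T}"
        from sys(2)[OF this] show "fst (Y s) = integral {0..s} (\<lambda>t. F t c 0)"
          by (simp add: s0 u_def w_def has_integral_iff)
      qed
      finally show "snd (Y T) = integral {0..T} (\<lambda>s. integral {0..s} (\<lambda>t. F t c 0))" .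
      show "x = \<bar>c\<bar>" unfolding x[symmetric] by (simp add: \<nu>_def s0)
    qed
    from inC[unfolded x] consider
        "snd (Y T) = 0" "\<sigma> \<le> 1" "x = r"
      | "snd (Y T) = 0" "\<sigma> = 1" "min r R \<le> x" "x \<le> max r R"
      | "snd (Y T) = 0" "1 \<le> \<sigma>" "x = R"
      | "snd (Y T) = 0" "\<sigma> = 2" "x \<le> R"
      | "\<sigma> = 0" "c = r" "0 \<le> snd (Y T)"
      | "\<sigma> = 0" "c = - r" "snd (Y T) \<le> 0"
      by blast
    then show False
    proof cases
      \<comment> \<open>The hypothesis \<open>at_r\<close> speaks of \<theta> > 0 only; at \<sigma>
        = 0 norm r means c = r or c = -r, where J(T) is known to be nonzero.\<close>
      case 1
      show False
      proof (cases "\<sigma> = 0")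
        case True
        then have "c = r \<or> c = - r" using zero 1 by linarith
        with zero(1)[OF True] 1 left right show False by auto
      next
        case False
        then have "scale \<sigma> = \<sigma>" "forcing \<sigma> = 0" using \<sigma> 1 by (auto simp: scale_def forcing_def)
        with per at_r[of \<sigma> u w] 1 False \<sigma> show False by (simp add: x_def)
      qed
    next
      case 2
      then have "scale \<sigma> = 1" "forcing \<sigma> = 0" by (auto simp: scale_def forcing_def)
      with per 2 have per1: "periodic_trajectory 1 0 u w" by simp
      with at_r[of 1 u w] at_R[of 0 u w] \<alpha>\<^sub>0_pos have "x \<noteq> r" "x \<noteq> R" by (auto simp: x_def)
      with 2 have "min r R < x" "x < max r R" by (auto simp: min_def max_def split: if_splits)
      with contr per1 show False by (auto simp: x_def)
    next
      case 3
      then have "scale \<sigma> = 1" by (auto simp: scale_def)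
      with per at_R[OF forcing_range, of \<sigma> u w] 3 show False by (simp add: x_def)
    next
      case 4
      then have "scale \<sigma> = 1" "forcing \<sigma> = \<alpha>\<^sub>0" by (auto simp: scale_def forcing_def)
      with per none[of u w] 4 show False by (simp add: x_def)
    next
      case 5
      with zero(1) right show False by simp
    next
      case 6
      with zero(1) left show False by simp
    qed
  qed
  obtain n \<epsilon> where n: "n > 0" and \<epsilon>: "\<epsilon> > 0" and
    nC: "\<And>p z. p \<in> K \<Longrightarrow> dist z (sys.euler n p n) < \<epsilon> \<Longrightarrow>
      (p, Max ((\<lambda>i. \<nu> p (sys.euler n p i)) ` {..n}), z) \<notin> C"
  proof (rule sys.euler_avoids_closed[OF \<open>compact K\<close> \<open>closed C\<close> \<nu>_cont])
    show "(p, \<nu> p (Y \<tau>), Y T) \<notin> C"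
      if "p \<in> K" "sys.solution p Y" "\<tau> \<in> {0..T}"
        "\<And>t. t \<in> {0..T} \<Longrightarrow> \<nu> p (Y t) \<le> \<nu> p (Y \<tau>)" for p Y \<tau>
      by (rule avoid[OF that])
  qed (rule that)
  \<comment> \<open>The minus sign makes the defect positive at c = r, where J(T) < 0, as
    \<open>no_degree_jump\<close> expects.\<close>
  define \<Delta> where "\<Delta> p = - snd (sys.euler n p n)" for p
  define X where "X p = Max ((\<lambda>i. \<nu> p (sys.euler n p i)) ` {..n})" for p
  have away: "((c, \<sigma>), X (c, \<sigma>), (i, j)) \<notin> C"
    if "\<bar>c\<bar> \<le> L" "0 \<le> \<sigma>" "\<sigma> \<le> 2" "i = fst (sys.euler n (c, \<sigma>) n)" "\<bar>j + \<Delta> (c, \<sigma>)\<bar> < \<epsilon>" for c \<sigma> i j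
  proof -
    have "dist (i, j) (sys.euler n (c, \<sigma>) n) = \<bar>j + \<Delta> (c, \<sigma>)\<bar>"
      using that(4) by (simp add: dist_prod_def dist_real_def \<Delta>_def)
    moreover have "(c, \<sigma>) \<in> K" using that by (auto simp: K_def)
    ultimately show ?thesis
      using nC[of "(c, \<sigma>)" "(i, j)"] that(5) unfolding X_def by simp
  qed
  have X_ge: "\<bar>c\<bar> \<le> X (c, \<sigma>)" for c \<sigma>
  proof -
    have "\<nu> (c, \<sigma>) (sys.euler n (c, \<sigma>) 0) \<le> X (c, \<sigma>)"
      unfolding X_def by (rule Max_ge) (simp, rule image_eqI[of _ _ 0], simp_all)
    then show ?thesis by (simp add: \<nu>_def)
  qed
  \<comment> \<open>Contraposition: if the defect were smaller than \<epsilon>, setting the J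
    component of the end point to 0 would be an admissible perturbation that lands in C.\<close>
  have \<Delta>_ge: "\<epsilon> \<le> \<bar>\<Delta> (c, \<sigma>)\<bar>"
    if "((c, \<sigma>), X (c, \<sigma>), (fst (sys.euler n (c, \<sigma>) n), 0)) \<in> C" "0 \<le> \<sigma>" "\<sigma> \<le> 2"
      "X (c, \<sigma>) \<le> L" for c \<sigma>
  proof (rule ccontr)
    assume "\<not> \<epsilon> \<le> \<bar>\<Delta> (c, \<sigma>)\<bar>"
    then have "((c, \<sigma>), X (c, \<sigma>), (fst (sys.euler n (c, \<sigma>) n), 0)) \<notin> C"
      using that X_ge[of c \<sigma>] by (intro away) auto
    with that(1) show False by contradiction
  qed
  have X_L: "X z \<le> L" if "X z \<le> max r R" for z using that by (simp add: L_def)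
  show False
  proof (rule no_degree_jump[of \<Delta> X \<epsilon> r L R])
    show "continuous_on UNIV \<Delta>"
      unfolding \<Delta>_def by (intro continuous_intros sys.continuous_euler) simp
    show "continuous_on UNIV X"
      unfolding X_def \<nu>_def scale_def
      by (intro continuous_on_Max_image continuous_intros sys.continuous_euler) auto
    show "X (c, 0) = \<bar>c\<bar>" for c
    proof -
      have "(\<lambda>i. \<nu> (c, 0) (sys.euler n (c, 0) i)) ` {..n} = {\<bar>c\<bar>}"
        by (auto simp: \<nu>_def scale_def)
      then show ?thesis by (simp add: X_def)
    qed
    show "\<epsilon> \<le> \<bar>\<Delta> (c, \<sigma>)\<bar>" if "0 \<le> \<sigma>" "\<sigma> \<le> 1" "X (c, \<sigma>) = r" for c \<sigma>
      by (rule \<Delta>_ge[OF _ _ _ X_L]) (use that in \<open>auto simp: C_iff\<close>)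
    show "\<epsilon> \<le> \<bar>\<Delta> (c, 1)\<bar>" if "min r R \<le> X (c, 1)" "X (c, 1) \<le> max r R" for c
      by (rule \<Delta>_ge[OF _ _ _ X_L]) (use that in \<open>auto simp: C_iff\<close>)
    show "\<epsilon> \<le> \<bar>\<Delta> (c, \<sigma>)\<bar>" if "1 \<le> \<sigma>" "\<sigma> \<le> 2" "X (c, \<sigma>) = R" for c \<sigma>
      by (rule \<Delta>_ge[OF _ _ _ X_L]) (use that in \<open>auto simp: C_iff\<close>)
    show "\<epsilon> \<le> \<bar>\<Delta> (c, 2)\<bar>" if "X (c, 2) \<le> R" for c
      by (rule \<Delta>_ge[OF _ _ _ X_L]) (use that in \<open>auto simp: C_iff\<close>)
    show "\<epsilon> \<le> \<Delta> (r, 0)"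
    proof (rule ccontr)
      assume "\<not> \<epsilon> \<le> \<Delta> (r, 0)"
      \<comment> \<open>The witness is the point of the forbidden half-line nearest to the J
        component of the Euler end point.\<close>
      then have "\<bar>max 0 (- \<Delta> (r, 0)) + \<Delta> (r, 0)\<bar> < \<epsilon>" using \<epsilon> by linarith
      then have "((r, 0), X (r, 0), (fst (sys.euler n (r, 0) n), max 0 (- \<Delta> (r, 0)))) \<notin> C"
        using r by (intro away) (auto simp: L_def)
      then show False by (simp add: C_iff)
    qed
    show "\<Delta> (- r, 0) \<le> - \<epsilon>"
    proof (rule ccontr)
      assume "\<not> \<Delta> (- r, 0) \<le> - \<epsilon>"
      then have "\<bar>min 0 (- \<Delta> (- r, 0)) + \<Delta> (- r, 0)\<bar> < \<epsilon>" using \<epsilon> by linarith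
      then have "((- r, 0), X (- r, 0), (fst (sys.euler n (- r, 0) n), min 0 (- \<Delta> (- r, 0)))) \<notin> C"
        using r by (intro away) (auto simp: L_def)
      then show False by (simp add: C_iff)
    qed
  qed (use \<epsilon> r X_ge in \<open>auto simp: L_def\<close>)
qed

end

subsection \<open>Growth conditions\<close>

lemma enn2real_ge_1:
  assumes "1 \<le> p" "p \<noteq> \<infinity>"
  shows "1 \<le> enn2real p"
  using enn2real_mono[of 1 p] assms by (simp add: top.not_eq_extremum)

text \<open>On a set of finite measure |g| \<le> 1 + |g|^p, which is integrable.\<close>

lemma in_Lp_absolutely_integrable:
  assumes p: "1 \<le> p" and g: "in_Lp p T g"
  shows "g absolutely_integrable_on {0..T}"
proof -
  have fin: "finite_measure (lebesgue_on {0..T})"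
    by (rule finite_measure_lebesgue_on) simp
  have meas: "g \<in> borel_measurable (lebesgue_on {0..T})"
    using g by (simp add: in_Lp_def)
  have "integrable (lebesgue_on {0..T}) g"
  proof (cases "p = \<infinity>")
    case True
    then obtain C where "AE t in lebesgue_on {0..T}. \<bar>g t\<bar> \<le> C"
      using g by (auto simp: in_Lp_def)
    then have "AE t in lebesgue_on {0..T}. norm (g t) \<le> norm C"
      by eventually_elim auto
    then show ?thesis
      by (rule Bochner_Integration.integrable_bound[OF finite_measure.integrable_const[OF fin] meas])
  next
    case False
    then have int: "integrable (lebesgue_on {0..T}) (\<lambda>t. \<bar>g t\<bar> powr enn2real p)"
      using g by (simp add: in_Lp_def)
    have "norm (g t) \<le> norm (1 + \<bar>g t\<bar> powr enn2real p)" for t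
    proof (cases "\<bar>g t\<bar> \<le> 1")
      case True
      then have "\<bar>g t\<bar> \<le> 1 + \<bar>g t\<bar> powr enn2real p"
        using powr_ge_zero[of "\<bar>g t\<bar>" "enn2real p"] by linarith
      then show ?thesis by simp
    next
      case False
      then have "\<bar>g t\<bar> powr 1 \<le> \<bar>g t\<bar> powr enn2real p"
        using enn2real_ge_1[OF p \<open>p \<noteq> \<infinity>\<close>] by (intro powr_mono) auto
      with False show ?thesis by simp
    qed
    then have "AE t in lebesgue_on {0..T}. norm (g t) \<le> norm (1 + \<bar>g t\<bar> powr enn2real p)"
      by (intro AE_I2)
    then show ?thesis
      by (rule Bochner_Integration.integrable_bound[
            OF Bochner_Integration.integrable_add[OF finite_measure.integrable_const[OF fin] int] meas])
  qed
  then show ?thesis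
    by (simp add: integrable_restrict_space set_integrable_def)
qed

text \<open>The inequality |y| * \<xi>^((P-1)/P) \<le> |y|^P + \<xi> holds with constant 1,
  according to whether |y| or \<xi>^(1/P) is larger. For p = \<infinity> the exponent is 1 and m = 0
  will do.\<close>

lemma in_Lp_young:
  assumes p: "1 \<le> p" and \<psi>: "in_Lp p T \<psi>"
  obtains m C where "m integrable_on {0..T}" "\<And>t. 0 \<le> m t" "0 \<le> C"
    "AE t in lebesgue_on {0..T}. \<forall>\<xi>>0. \<bar>\<psi> t\<bar> * \<xi> powr nagumo_exponent p \<le> m t + C * \<xi>"
proof (cases "p = \<infinity>")
  case True
  then obtain C where "AE t in lebesgue_on {0..T}. \<bar>\<psi> t\<bar> \<le> C"
    using \<psi> by (auto simp: in_Lp_def)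
  then have "AE t in lebesgue_on {0..T}. \<forall>\<xi>>0. \<bar>\<psi> t\<bar> * \<xi> powr nagumo_exponent p \<le> 0 + \<bar>C\<bar> * \<xi>"
    by eventually_elim (use True in \<open>auto simp: nagumo_exponent_def intro!: mult_right_mono\<close>)
  then show thesis by (intro that[of "\<lambda>_. 0" "\<bar>C\<bar>"]) auto
next
  case False
  define P where "P = enn2real p"
  have P: "1 \<le> P" unfolding P_def by (rule enn2real_ge_1[OF p False])
  have e: "nagumo_exponent p = (P - 1) / P" using False by (simp add: nagumo_exponent_def P_def)
  have young: "\<bar>y\<bar> * \<xi> powr ((P - 1) / P) \<le> \<bar>y\<bar> powr P + 1 * \<xi>" if "\<xi> > 0" for y \<xi> :: real
  proof (cases "\<bar>y\<bar> \<le> \<xi> powr (1 / P)")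
    case True
    then have "\<bar>y\<bar> * \<xi> powr ((P - 1) / P) \<le> \<xi> powr (1 / P) * \<xi> powr ((P - 1) / P)"
      by (intro mult_right_mono) auto
    also have "\<dots> = \<xi> powr (1 / P + (P - 1) / P)" by (simp add: powr_add)
    also have "1 / P + (P - 1) / P = 1" using P by (simp add: field_simps)
    finally show ?thesis using that by (simp add: add_increasing)
  next
    case False
    then have y: "\<bar>y\<bar> > 0" by (meson not_less order_trans powr_ge_zero le_less_trans)
    have "\<xi> powr ((P - 1) / P) = (\<xi> powr (1 / P)) powr (P - 1)"
      by (simp add: powr_powr)
    also have "\<dots> \<le> \<bar>y\<bar> powr (P - 1)"
      using False P by (intro powr_mono2) auto
    finally have "\<bar>y\<bar> * \<xi> powr ((P - 1) / P) \<le> \<bar>y\<bar> * \<bar>y\<bar> powr (P - 1)"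
      by (intro mult_left_mono) auto
    also have "\<dots> = \<bar>y\<bar> powr P"
      using y powr_add[of "\<bar>y\<bar>" 1 "P - 1"] by simp
    finally show ?thesis using that by simp
  qed
  have "integrable (lebesgue_on {0..T}) (\<lambda>t. \<bar>\<psi> t\<bar> powr P)"
    using \<psi> False by (simp add: in_Lp_def P_def)
  then have "(\<lambda>t. \<bar>\<psi> t\<bar> powr P) integrable_on {0..T}"
    by (rule integrable_on_lebesgue_on) simp
  then show thesis
    by (rule that[of _ 1]) (use young e in auto)
qed

text \<open>If all the integrals over [a, M] were bounded, the increasing primitive would converge,
  and the fundamental theorem on a half-line would make the improper integral finite.\<close>

lemma integral_exceeds_if_divergent:
  fixes q :: "real \<Rightarrow> real"
  assumes q: "continuous_on {a..} q" "\<And>x. a \<le> x \<Longrightarrow> 0 \<le> q x"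
    and div: "(\<integral>\<^sup>+x\<in>{a..}. ennreal (q x) \<partial>lborel) = \<infinity>"
  shows "\<exists>M>a. B < integral {a..M} q"
proof (rule ccontr)
  assume "\<not> ?thesis"
  then have le: "integral {a..M} q \<le> B" if "M > a" for M using that by force
  \<comment> \<open>The continuation to the left of a, with the primitive based at a - 1, provides a
    two-sided derivative at a itself.\<close>
  define q' where "q' x = q (max a x)" for x
  have q'c: "continuous_on UNIV q'"
    unfolding q'_def by (intro continuous_on_compose2[OF q(1)] continuous_intros) auto
  have q'0: "0 \<le> q' x" for x unfolding q'_def by (rule q(2)) simp
  have qi: "q' integrable_on {x..y}" for x y
    by (intro integrable_continuous_real continuous_on_subset[OF q'c]) simp
  define \<Phi> where "\<Phi> x = integral {a - 1..x} q'" for x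
  have \<Phi>_split: "\<Phi> y = \<Phi> x + integral {x..y} q'" if "a - 1 \<le> x" "x \<le> y" for x y
    unfolding \<Phi>_def using Henstock_Kurzweil_Integration.integral_combine[OF that qi] by simp
  have \<Phi>_mono: "\<Phi> x \<le> \<Phi> y" if "a - 1 \<le> x" "x \<le> y" for x y
    using \<Phi>_split[OF that] integral_nonneg[OF qi q'0] by simp
  have \<Phi>_le: "\<Phi> x \<le> \<Phi> a + \<bar>B\<bar>" if "a \<le> x" for x
  proof -
    have "integral {a..x} q' = integral {a..x} q"
      by (rule integral_cong) (simp add: q'_def)
    then show ?thesis using \<Phi>_split[of a x] le[of x] that by (cases "x = a") auto
  qed
  have bdd: "bdd_above (\<Phi> ` {a..})"
    using \<Phi>_le by (intro bdd_aboveI[of _ "\<Phi> a + \<bar>B\<bar>"]) auto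
  define S where "S = (SUP x\<in>{a..}. \<Phi> x)"
  have lim: "(\<Phi> \<longlongrightarrow> S) at_top"
  proof (rule increasing_tendsto)
    show "\<forall>\<^sub>F x in at_top. \<Phi> x \<le> S"
      using eventually_ge_at_top[of a]
      by eventually_elim (auto simp: S_def intro!: cSUP_upper bdd)
    fix l assume "l < S"
    then obtain x where x: "a \<le> x" "l < \<Phi> x"
      unfolding S_def using less_cSUP_iff[OF _ bdd, of l] by auto
    show "\<forall>\<^sub>F x in at_top. l < \<Phi> x"
      using eventually_ge_at_top[of x]
    proof eventually_elim
      case (elim y)
      then show ?case using x \<Phi>_mono[of x y] by simp
    qed
  qed
  have "(\<integral>\<^sup>+x. ennreal (q' x) * indicator {a..} x \<partial>lborel) = ennreal (S - \<Phi> a)"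
  proof (rule nn_integral_FTC_atLeast[OF _ _ q'0 lim])
    show "q' \<in> borel_measurable borel"
      by (rule borel_measurable_continuous_onI[OF q'c])
    fix x assume "a \<le> x"
    have "((\<lambda>u. integral {a - 1..u} q') has_real_derivative q' x) (at x within {a - 1..x + 1})"
      using \<open>a \<le> x\<close>
      by (intro integral_has_real_derivative continuous_on_subset[OF q'c]) auto
    then show "(\<Phi> has_real_derivative q' x) (at x)"
      using \<open>a \<le> x\<close> at_within_interior[of x "{a - 1..x + 1}"] by (simp add: \<Phi>_def[abs_def])
  qed
  moreover have "(\<integral>\<^sup>+x. ennreal (q' x) * indicator {a..} x \<partial>lborel) =
      (\<integral>\<^sup>+x\<in>{a..}. ennreal (q x) \<partial>lborel)"
    by (rule nn_integral_cong) (auto simp: q'_def indicator_def)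
  ultimately show False using div by simp
qed

text \<open>With q = \<xi>^e / \<phi>, where e is the Nagumo exponent, q * |f| is at most |\<psi>| *
  \<xi>^e, to which \<open>in_Lp_young\<close> applies. The forcing is treated likewise once \<phi>
  is bounded below. As the integral of q diverges, M can be taken beyond any prescribed
  bound.\<close>

lemma nagumo_growth:
  assumes p: "1 \<le> p" and f3: "cond_f3 p T f" and v: "in_Lp p T v" and "\<eta> > 0" "\<alpha>\<^sub>0 > 0"
  obtains a M C :: real and q m :: "real \<Rightarrow> real" where
    "0 < a" "a < M" "continuous_on {a..M} q" "\<And>x. x \<in> {a..M} \<Longrightarrow> 0 \<le> q x"
    "m integrable_on {0..T}" "\<And>t. 0 \<le> m t" "0 \<le> C"
    "integral {0..T} m + C * \<eta> < integral {a..M} q"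
    "AE t in lebesgue_on {0..T}. \<forall>s \<xi> \<alpha>. 0 \<le> s \<longrightarrow> s \<le> \<eta> \<longrightarrow> a \<le> \<bar>\<xi>\<bar> \<longrightarrow> 0 \<le> \<alpha> \<longrightarrow> \<alpha> \<le> \<alpha>\<^sub>0 \<longrightarrow>
       q \<bar>\<xi>\<bar> * \<bar>f t s \<xi> + \<alpha> * v t\<bar> \<le> m t + C * \<bar>\<xi>\<bar>"
proof -
  obtain \<phi> \<psi> where \<phi>: "continuous_on {0..} \<phi>"
      "\<forall>\<^sub>F a in at_top. (\<integral>\<^sup>+\<xi>\<in>{a..}. ennreal (\<xi> powr nagumo_exponent p / \<phi> \<xi>) \<partial>lborel) = \<infinity>"
      "0 < Liminf at_top (\<lambda>\<xi>. ereal (\<phi> \<xi>))"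
    and \<psi>: "in_Lp p T \<psi>"
      "AE t in lebesgue_on {0..T}. \<forall>s \<xi>. 0 \<le> s \<longrightarrow> s \<le> \<eta> \<longrightarrow> \<bar>f t s \<xi>\<bar> \<le> \<psi> t * \<phi> \<bar>\<xi>\<bar>"
    using f3 \<open>\<eta> > 0\<close> unfolding cond_f3_def by blast
  obtain y where y: "0 < y" "y < Liminf at_top (\<lambda>\<xi>. ereal (\<phi> \<xi>))"
    using dense[OF \<phi>(3)] by blast
  \<comment> \<open>The lower limit of \<phi> may be infinite, so a finite number strictly below it
    is used.\<close>
  define \<delta> where "\<delta> = real_of_ereal y"
  have "y = ereal \<delta>" using y by (cases y) (auto simp: \<delta>_def)
  then have "\<delta> > 0" using y by simp
  have "\<forall>\<^sub>F \<xi> in at_top. \<delta> < \<phi> \<xi>"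
    using less_LiminfD[OF y(2)] unfolding \<open>y = ereal \<delta>\<close> by simp
  then obtain a0 where a0: "\<And>\<xi>. a0 \<le> \<xi> \<Longrightarrow> \<delta> < \<phi> \<xi>"
    unfolding eventually_at_top_linorder by blast
  obtain a where a: "1 \<le> a" "a0 \<le> a"
    "(\<integral>\<^sup>+\<xi>\<in>{a..}. ennreal (\<xi> powr nagumo_exponent p / \<phi> \<xi>) \<partial>lborel) = \<infinity>"
    using eventually_happens[OF eventually_conj[OF eventually_conj[OF eventually_ge_at_top[of 1]
          eventually_ge_at_top[of a0]] \<phi>(2)]] by auto
  define q where "q \<xi> = \<xi> powr nagumo_exponent p / \<phi> \<xi>" for \<xi>
  have \<phi>a: "\<delta> < \<phi> \<xi>" if "a \<le> \<xi>" for \<xi> using that a a0 by auto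
  have q: "continuous_on {a..} q"
    unfolding q_def using a \<phi>a \<open>\<delta> > 0\<close>
    by (intro continuous_intros continuous_on_subset[OF \<phi>(1)]) force+
  have q0: "0 \<le> q \<xi>" if "a \<le> \<xi>" for \<xi>
    unfolding q_def using \<phi>a[OF that] \<open>\<delta> > 0\<close> by simp
  obtain m1 C1 where 1: "m1 integrable_on {0..T}" "\<And>t. 0 \<le> m1 t" "0 \<le> C1"
    "AE t in lebesgue_on {0..T}. \<forall>\<xi>>0. \<bar>\<psi> t\<bar> * \<xi> powr nagumo_exponent p \<le> m1 t + C1 * \<xi>"
    using in_Lp_young[OF p \<psi>(1)] by blast
  obtain m2 C2 where 2: "m2 integrable_on {0..T}" "\<And>t. 0 \<le> m2 t" "0 \<le> C2"
    "AE t in lebesgue_on {0..T}. \<forall>\<xi>>0. \<bar>v t\<bar> * \<xi> powr nagumo_exponent p \<le> m2 t + C2 * \<xi>"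
    using in_Lp_young[OF p v] by blast
  \<comment> \<open>A bound for \<alpha> / \<phi> on [a, \<infinity>), valid for all admissible
    \<alpha>.\<close>
  define b where "b = \<alpha>\<^sub>0 / \<delta>"
  have "b \<ge> 0" using \<open>\<alpha>\<^sub>0 > 0\<close> \<open>\<delta> > 0\<close> by (simp add: b_def)
  define m where "m t = m1 t + b * m2 t" for t
  define C where "C = C1 + b * C2"
  obtain M where M: "a < M" "integral {0..T} m + C * \<eta> < integral {a..M} q"
    using integral_exceeds_if_divergent[OF q q0] a(3) unfolding q_def[symmetric] by metis
  show thesis
  proof (rule that[of a M q m C])
    show "m integrable_on {0..T}"
      unfolding m_def by (intro integrable_add 1 integrable_on_mult_right 2)
    show "0 \<le> m t" for t using 1(2) 2(2) \<open>b \<ge> 0\<close> by (simp add: m_def)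
    show "0 \<le> C" using 1(3) 2(3) \<open>b \<ge> 0\<close> by (simp add: C_def)
    show "continuous_on {a..M} q" by (rule continuous_on_subset[OF q]) auto
    show "AE t in lebesgue_on {0..T}. \<forall>s \<xi> \<alpha>. 0 \<le> s \<longrightarrow> s \<le> \<eta> \<longrightarrow> a \<le> \<bar>\<xi>\<bar> \<longrightarrow> 0 \<le> \<alpha> \<longrightarrow> \<alpha> \<le> \<alpha>\<^sub>0 \<longrightarrow>
       q \<bar>\<xi>\<bar> * \<bar>f t s \<xi> + \<alpha> * v t\<bar> \<le> m t + C * \<bar>\<xi>\<bar>"
      using \<psi>(2) 1(4) 2(4)
    proof eventually_elim
      case (elim t)
      show ?case
      proof (intro allI impI)
        fix s \<xi> \<alpha> :: real assume s: "0 \<le> s" "s \<le> \<eta>" and \<xi>: "a \<le> \<bar>\<xi>\<bar>" and \<alpha>: "0 \<le> \<alpha>" "\<alpha> \<le> \<alpha>\<^sub>0"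
        have \<xi>0: "\<bar>\<xi>\<bar> > 0" using \<xi> a by linarith
        note \<phi>\<xi> = \<phi>a[OF \<xi>]
        define e where "e = \<bar>\<xi>\<bar> powr nagumo_exponent p"
        have e0: "e \<ge> 0" by (simp add: e_def)
        have "\<psi> t * \<phi> \<bar>\<xi>\<bar> \<le> \<bar>\<psi> t\<bar> * \<phi> \<bar>\<xi>\<bar>"
          using \<phi>\<xi> \<open>\<delta> > 0\<close> by (intro mult_right_mono) auto
        moreover have "\<bar>f t s \<xi>\<bar> \<le> \<psi> t * \<phi> \<bar>\<xi>\<bar>" using elim(1) s by blast
        moreover have "\<bar>\<alpha> * v t\<bar> \<le> \<alpha>\<^sub>0 * \<bar>v t\<bar>"
          unfolding abs_mult using \<alpha> by (intro mult_right_mono) auto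
        ultimately have "\<bar>f t s \<xi> + \<alpha> * v t\<bar> \<le> \<bar>\<psi> t\<bar> * \<phi> \<bar>\<xi>\<bar> + \<alpha>\<^sub>0 * \<bar>v t\<bar>" by linarith
        then have "q \<bar>\<xi>\<bar> * \<bar>f t s \<xi> + \<alpha> * v t\<bar> \<le> q \<bar>\<xi>\<bar> * (\<bar>\<psi> t\<bar> * \<phi> \<bar>\<xi>\<bar> + \<alpha>\<^sub>0 * \<bar>v t\<bar>)"
          by (rule mult_left_mono) (rule q0[OF \<xi>])
        also have "\<dots> = \<bar>\<psi> t\<bar> * e + (\<alpha>\<^sub>0 / \<phi> \<bar>\<xi>\<bar>) * (\<bar>v t\<bar> * e)"
          using \<phi>\<xi> \<open>\<delta> > 0\<close> by (simp add: q_def e_def field_simps)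
        also have "\<dots> \<le> (m1 t + C1 * \<bar>\<xi>\<bar>) + b * (m2 t + C2 * \<bar>\<xi>\<bar>)"
        proof (intro add_mono mult_mono)
          show "\<bar>\<psi> t\<bar> * e \<le> m1 t + C1 * \<bar>\<xi>\<bar>" using elim(2) \<xi>0 by (auto simp: e_def)
          show "\<bar>v t\<bar> * e \<le> m2 t + C2 * \<bar>\<xi>\<bar>" using elim(3) \<xi>0 by (auto simp: e_def)
          show "\<alpha>\<^sub>0 / \<phi> \<bar>\<xi>\<bar> \<le> b"
            unfolding b_def using \<phi>\<xi> \<open>\<delta> > 0\<close> \<open>\<alpha>\<^sub>0 > 0\<close> by (intro divide_left_mono) auto
        qed (use \<open>b \<ge> 0\<close> e0 in auto)
        also have "\<dots> = m t + C * \<bar>\<xi>\<bar>" by (simp add: m_def C_def algebra_simps)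
        finally show "q \<bar>\<xi>\<bar> * \<bar>f t s \<xi> + \<alpha> * v t\<bar> \<le> m t + C * \<bar>\<xi>\<bar>" .
      qed
    qed
  qed (use a M q0 in auto)
qed

subsection \<open>The boundary value problem\<close>

lemma absolutely_integrable_spike_AE:
  fixes f :: "real \<Rightarrow> real"
  assumes f: "f absolutely_integrable_on {a..b}" and N: "negligible N"
    and eq: "\<And>t. t \<in> {a..b} - N \<Longrightarrow> g t = f t"
  shows "g integrable_on {a..b}"
  by (rule integrable_spike[OF set_lebesgue_integral_eq_integral(1)[OF f] N]) (rule eq)

lemma caratheodory_absolutely_integrable:
  assumes "1 \<le> p" "in_Lp p T g"
    and "h \<in> borel_measurable (lebesgue_on {0..T})" "AE t in lebesgue_on {0..T}. \<bar>h t\<bar> \<le> g t"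
  shows "h absolutely_integrable_on {0..T}"
proof -
  have "integrable (lebesgue_on {0..T}) g"
    using in_Lp_absolutely_integrable[OF assms(1,2)]
    by (simp add: integrable_restrict_space set_integrable_def)
  moreover have "AE t in lebesgue_on {0..T}. norm (h t) \<le> norm (g t)"
    using assms(4) by eventually_elim auto
  ultimately have "integrable (lebesgue_on {0..T}) h"
    using assms(3) Bochner_Integration.integrable_bound by blast
  then show ?thesis
    by (simp add: integrable_restrict_space set_integrable_def)
qed

theorem theorem6p1:
  fixes T r R :: real
    and p :: ennreal
    and f :: "real \<Rightarrow> real \<Rightarrow> real \<Rightarrow> real"
  assumes "T > 0"
    and "1 \<le> p"
    and "Lp_caratheodory p T f"
    and "cond_f1 T f"
    and "cond_f2 T f"
    and "cond_f3 p T f"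
    and "r > 0"
    and "R > 0"
    and "r \<noteq> R"
    and "cond_Hr T f r"
    and "cond_HR p T f R"
  shows "\<exists>u. bvp_solution T f u \<and> (\<forall>t\<in>{0..T}. 0 < u t) \<and>
           min r R < (SUP t\<in>{0..T}. u t) \<and> (SUP t\<in>{0..T}. u t) < max r R"
proof -
  \<comment> \<open>All norms that matter lie below this level, so truncating s above it changes no
    relevant solution.\<close>
  define \<eta> where "\<eta> = max r R"
  have \<eta>: "\<eta> > 0" "r \<le> \<eta>" "R \<le> \<eta>" using \<open>r > 0\<close> by (auto simp: \<eta>_def)
  obtain v \<alpha>\<^sub>0 where v: "in_Lp p T v" "AE t in lebesgue_on {0..T}. 0 \<le> v t" and \<alpha>\<^sub>0: "\<alpha>\<^sub>0 > 0"
    and HR_raw: "\<forall>\<alpha>\<in>{0..\<alpha>\<^sub>0}. \<forall>u. bvp_solution T (\<lambda>t s \<xi>. f t s \<xi> + \<alpha> * v t) u \<longrightarrow>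
        (\<forall>t\<in>{0..T}. 0 \<le> u t) \<longrightarrow> sup_norm_on T u \<noteq> R"
    and none: "\<not> (\<exists>u. bvp_solution T (\<lambda>t s \<xi>. f t s \<xi> + \<alpha>\<^sub>0 * v t) u \<and>
        (\<forall>t\<in>{0..T}. 0 \<le> u t \<and> u t \<le> R))"
    using \<open>cond_HR p T f R\<close> unfolding cond_HR_def by (elim exE conjE) (rule that)
  have HR: "sup_norm_on T u \<noteq> R"
    if "0 \<le> \<alpha>" "\<alpha> \<le> \<alpha>\<^sub>0" "bvp_solution T (\<lambda>t s \<xi>. f t s \<xi> + \<alpha> * v t) u"
      "\<forall>t\<in>{0..T}. 0 \<le> u t" for \<alpha> u
    using HR_raw[rule_format, of \<alpha> u] that by auto
  obtain a M C :: real and q m :: "real \<Rightarrow> real" where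
    a: "0 < a" "a < M" and q: "continuous_on {a..M} q" "\<And>x. x \<in> {a..M} \<Longrightarrow> 0 \<le> q x"
    and m: "m integrable_on {0..T}" "\<And>t. 0 \<le> m t" and C: "0 \<le> C"
    and M: "integral {0..T} m + C * \<eta> < integral {a..M} q"
    and growth: "AE t in lebesgue_on {0..T}. \<forall>s \<xi> \<alpha>. 0 \<le> s \<longrightarrow> s \<le> \<eta> \<longrightarrow> a \<le> \<bar>\<xi>\<bar> \<longrightarrow> 0 \<le> \<alpha> \<longrightarrow>
       \<alpha> \<le> \<alpha>\<^sub>0 \<longrightarrow> q \<bar>\<xi>\<bar> * \<bar>f t s \<xi> + \<alpha> * v t\<bar> \<le> m t + C * \<bar>\<xi>\<bar>"
    by (rule nagumo_growth[OF \<open>1 \<le> p\<close> \<open>cond_f3 p T f\<close> v(1) \<eta>(1) \<alpha>\<^sub>0]) (rule that)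
  have "M > 0" using a by simp
  have meas: "(\<lambda>t. f t s \<xi>) \<in> borel_measurable (lebesgue_on {0..T})" if "0 \<le> s" for s \<xi>
    using \<open>Lp_caratheodory p T f\<close> that by (auto simp: Lp_caratheodory_def)
  have fcont: "AE t in lebesgue_on {0..T}. continuous_on ({0..} \<times> UNIV) (\<lambda>(s, \<xi>). f t s \<xi>)"
    using \<open>Lp_caratheodory p T f\<close> by (auto simp: Lp_caratheodory_def)
  have "max \<eta> M > 0" using \<eta> by simp
  then obtain g where g: "in_Lp p T g" and gAE: "AE t in lebesgue_on {0..T}.
      \<forall>s \<xi>. 0 \<le> s \<longrightarrow> \<bar>s\<bar> \<le> max \<eta> M \<longrightarrow> \<bar>\<xi>\<bar> \<le> max \<eta> M \<longrightarrow> \<bar>f t s \<xi>\<bar> \<le> g t"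
    using \<open>Lp_caratheodory p T f\<close> unfolding Lp_caratheodory_def by meson
  obtain k \<rho> where k: "in_Lp 1 T k" and \<rho>: "\<rho> > 0"
    and kAE: "AE t in lebesgue_on {0..T}. 0 \<le> k t"
      "AE t in lebesgue_on {0..T}. \<forall>s \<xi>. 0 \<le> s \<longrightarrow> s \<le> \<rho> \<longrightarrow> \<bar>\<xi>\<bar> \<le> \<rho> \<longrightarrow>
           \<bar>f t s \<xi>\<bar> \<le> k t * (\<bar>s\<bar> + \<bar>\<xi>\<bar>)"
    using \<open>cond_f2 T f\<close> unfolding cond_f2_def by blast
  have f1: "AE t in lebesgue_on {0..T}. \<forall>\<xi>. f t 0 \<xi> = 0"
    using \<open>cond_f1 T f\<close> by (simp add: cond_f1_def)
  \<comment> \<open>All exceptional sets are merged into one null set N; with F and v modified on N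
    the pointwise assumptions of \<open>shooting\<close> hold everywhere.\<close>
  have "AE t in lebesgue_on {0..T}. 0 \<le> v t \<and>
      (\<forall>s \<xi> \<alpha>. 0 \<le> s \<longrightarrow> s \<le> \<eta> \<longrightarrow> a \<le> \<bar>\<xi>\<bar> \<longrightarrow> 0 \<le> \<alpha> \<longrightarrow>
        \<alpha> \<le> \<alpha>\<^sub>0 \<longrightarrow> q \<bar>\<xi>\<bar> * \<bar>f t s \<xi> + \<alpha> * v t\<bar> \<le> m t + C * \<bar>\<xi>\<bar>) \<and>
      continuous_on ({0..} \<times> UNIV) (\<lambda>(s, \<xi>). f t s \<xi>) \<and>
      (\<forall>s \<xi>. 0 \<le> s \<longrightarrow> \<bar>s\<bar> \<le> max \<eta> M \<longrightarrow> \<bar>\<xi>\<bar> \<le> max \<eta> M \<longrightarrow> \<bar>f t s \<xi>\<bar> \<le> g t) \<and>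
      0 \<le> k t \<and>
      (\<forall>s \<xi>. 0 \<le> s \<longrightarrow> s \<le> \<rho> \<longrightarrow> \<bar>\<xi>\<bar> \<le> \<rho> \<longrightarrow> \<bar>f t s \<xi>\<bar> \<le> k t * (\<bar>s\<bar> + \<bar>\<xi>\<bar>)) \<and>
      (\<forall>\<xi>. f t 0 \<xi> = 0)"
    using v(2) growth fcont gAE kAE f1 by (intro AE_conjI)
  then obtain N where N: "negligible N" and "\<forall>t\<in>{0..T} - N. 0 \<le> v t \<and>
      (\<forall>s \<xi> \<alpha>. 0 \<le> s \<longrightarrow> s \<le> \<eta> \<longrightarrow> a \<le> \<bar>\<xi>\<bar> \<longrightarrow> 0 \<le> \<alpha> \<longrightarrow>
        \<alpha> \<le> \<alpha>\<^sub>0 \<longrightarrow> q \<bar>\<xi>\<bar> * \<bar>f t s \<xi> + \<alpha> * v t\<bar> \<le> m t + C * \<bar>\<xi>\<bar>) \<and>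
      continuous_on ({0..} \<times> UNIV) (\<lambda>(s, \<xi>). f t s \<xi>) \<and>
      (\<forall>s \<xi>. 0 \<le> s \<longrightarrow> \<bar>s\<bar> \<le> max \<eta> M \<longrightarrow> \<bar>\<xi>\<bar> \<le> max \<eta> M \<longrightarrow> \<bar>f t s \<xi>\<bar> \<le> g t) \<and>
      0 \<le> k t \<and>
      (\<forall>s \<xi>. 0 \<le> s \<longrightarrow> s \<le> \<rho> \<longrightarrow> \<bar>\<xi>\<bar> \<le> \<rho> \<longrightarrow> \<bar>f t s \<xi>\<bar> \<le> k t * (\<bar>s\<bar> + \<bar>\<xi>\<bar>)) \<and>
      (\<forall>\<xi>. f t 0 \<xi> = 0)"
    unfolding AE_lebesgue_on_iff_negligible by blast
  then have v0: "\<And>t. t \<in> {0..T} - N \<Longrightarrow> 0 \<le> v t"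
    and growth': "\<And>t s \<xi> \<alpha>. t \<in> {0..T} - N \<Longrightarrow> 0 \<le> s \<Longrightarrow> s \<le> \<eta> \<Longrightarrow> a \<le> \<bar>\<xi>\<bar> \<Longrightarrow> 0 \<le> \<alpha> \<Longrightarrow>
        \<alpha> \<le> \<alpha>\<^sub>0 \<Longrightarrow> q \<bar>\<xi>\<bar> * \<bar>f t s \<xi> + \<alpha> * v t\<bar> \<le> m t + C * \<bar>\<xi>\<bar>"
    and fc: "\<And>t. t \<in> {0..T} - N \<Longrightarrow> continuous_on ({0..} \<times> UNIV) (\<lambda>(s, \<xi>). f t s \<xi>)"
    and fg: "\<And>t s \<xi>. t \<in> {0..T} - N \<Longrightarrow> 0 \<le> s \<Longrightarrow> \<bar>s\<bar> \<le> max \<eta> M \<Longrightarrow> \<bar>\<xi>\<bar> \<le> max \<eta> M \<Longrightarrow>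
        \<bar>f t s \<xi>\<bar> \<le> g t"
    and k0: "\<And>t. t \<in> {0..T} - N \<Longrightarrow> 0 \<le> k t"
    and fk: "\<And>t s \<xi>. t \<in> {0..T} - N \<Longrightarrow> 0 \<le> s \<Longrightarrow> s \<le> \<rho> \<Longrightarrow> \<bar>\<xi>\<bar> \<le> \<rho> \<Longrightarrow>
        \<bar>f t s \<xi>\<bar> \<le> k t * (\<bar>s\<bar> + \<bar>\<xi>\<bar>)"
    and f0: "\<And>t \<xi>. t \<in> {0..T} - N \<Longrightarrow> f t 0 \<xi> = 0"
    by blast+
  \<comment> \<open>Outside \<open>[0,\<eta>]\<close> and \<open>[-M,M]\<close> the nonlinearity is frozen; the extra term pushes negative trajectories back.\<close>
  define cs where "cs s = max 0 (min \<eta> s)" for s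
  define c\<xi> where "c\<xi> \<xi> = max (- M) (min M \<xi>)" for \<xi>
  define F where "F t s \<xi> = (if t \<in> {0..T} - N then f t (cs s) (c\<xi> \<xi>) else 0) + min 1 (max 0 (- s))"
    for t s \<xi>
  define v' where "v' t = (if t \<in> {0..T} - N then v t else 0)" for t
  have cs: "0 \<le> cs s" "\<bar>cs s\<bar> \<le> max \<eta> M" "\<bar>c\<xi> \<xi>\<bar> \<le> max \<eta> M" for s \<xi>
    using \<eta>(1) \<open>M > 0\<close> by (auto simp: cs_def c\<xi>_def)
  have gint: "g absolutely_integrable_on {0..T}"
    by (rule in_Lp_absolutely_integrable[OF \<open>1 \<le> p\<close> g])
  have fint: "(\<lambda>t. f t s \<xi>) absolutely_integrable_on {0..T}"
    if "0 \<le> s" "\<bar>s\<bar> \<le> max \<eta> M" "\<bar>\<xi>\<bar> \<le> max \<eta> M" for s \<xi>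
  proof (rule caratheodory_absolutely_integrable[OF \<open>1 \<le> p\<close> g meas[OF that(1)]])
    show "AE t in lebesgue_on {0..T}. \<bar>f t s \<xi>\<bar> \<le> g t"
      using gAE by eventually_elim (use that in blast)
  qed
  \<comment> \<open>The summand 1 dominates the restoring term.\<close>
  interpret shooting T \<alpha>\<^sub>0 F v' "\<lambda>t. \<bar>g t\<bar> + 1"
  proof
    show "(\<lambda>t. F t s \<xi>) integrable_on {0..T}" for s \<xi>
    proof -
      have "(\<lambda>t. if t \<in> {0..T} - N then f t (cs s) (c\<xi> \<xi>) else 0) integrable_on {0..T}"
        by (rule absolutely_integrable_spike_AE[OF fint[OF cs] N]) simp
      then show ?thesis unfolding F_def by (rule integrable_add) auto
    qed
    show "\<bar>F t s \<xi>\<bar> \<le> \<bar>g t\<bar> + 1" if "t \<in> {0..T}" for t s \<xi>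
    proof -
      have "\<bar>if t \<in> {0..T} - N then f t (cs s) (c\<xi> \<xi>) else 0\<bar> \<le> \<bar>g t\<bar>"
        using fg[OF _ cs, of t s \<xi>] by auto
      moreover have "\<bar>min 1 (max 0 (- s))\<bar> \<le> 1" by auto
      ultimately show ?thesis unfolding F_def by linarith
    qed
    show "continuous_on UNIV (\<lambda>(s, \<xi>). F t s \<xi>)" if "t \<in> {0..T}" for t
    proof -
      have clip: "continuous_on UNIV (\<lambda>z. (cs (fst z), c\<xi> (snd z)))"
        unfolding cs_def c\<xi>_def by (intro continuous_intros)
      have "continuous_on UNIV (\<lambda>z. f t (cs (fst z)) (c\<xi> (snd z)))" if "t \<in> {0..T} - N"
        using continuous_on_compose2[OF fc[OF that] clip] cs(1) by (simp add: image_subset_iff)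
      then have "continuous_on UNIV (\<lambda>z. if b then f t (cs (fst z)) (c\<xi> (snd z)) else 0)"
        if "b = (t \<in> {0..T} - N)" for b
        using that by (cases b) auto
      from this[OF refl]
      have "continuous_on UNIV (\<lambda>z. if t \<in> {0..T} - N then f t (cs (fst z)) (c\<xi> (snd z)) else 0)" .
      then show ?thesis
        unfolding F_def case_prod_unfold by (intro continuous_intros)
    qed
    have "(\<lambda>t. norm (g t)) integrable_on {0..T}"
      using gint unfolding absolutely_integrable_on_def by blast
    then show "(\<lambda>t. \<bar>g t\<bar> + 1) integrable_on {0..T}"
      by (intro integrable_add) auto
    show "v' integrable_on {0..T}"
      by (rule absolutely_integrable_spike_AE[OF in_Lp_absolutely_integrable[OF \<open>1 \<le> p\<close> v(1)] N])
         (simp add: v'_def)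
    show "0 \<le> v' t" for t using v0 by (simp add: v'_def)
  qed (use \<open>T > 0\<close> \<alpha>\<^sub>0 in auto)
  have F_eq: "F t s \<xi> = (if t \<in> {0..T} - N then f t s \<xi> else 0)"
    if "0 \<le> s" "s \<le> \<eta>" "\<bar>\<xi>\<bar> \<le> M" for t s \<xi>
    using that by (auto simp: F_def cs_def c\<xi>_def)
  \<comment> \<open>For s < 0 the clipped state is 0, where f vanishes by (f_1); what remains is the
    restoring term, whatever \<xi> is.\<close>
  have F_neg: "F t s \<xi> = min 1 (- s)" if "s < 0" for t s \<xi>
    using that f0 \<eta> by (auto simp: F_def cs_def)
  have apriori: "(\<forall>t\<in>{0..T}. 0 \<le> u t \<and> u t \<le> sup_norm_on T u \<and> \<bar>w t\<bar> < M) \<and>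
      bvp_solution T (\<lambda>t s \<xi>. \<theta> * (f t s \<xi> + \<alpha> * v t)) u"
    if traj: "periodic_trajectory \<theta> \<alpha> u w" and \<theta>: "0 < \<theta>" "\<theta> \<le> 1" and \<alpha>: "0 \<le> \<alpha>" "\<alpha> \<le> \<alpha>\<^sub>0"
      and le: "sup_norm_on T u \<le> \<eta>" for \<theta> \<alpha> u w
  proof -
    define h where "h t = \<theta> * (F t (u t) (w t) + \<alpha> * v' t)" for t
    interpret trajectory T h w u majorant
      using traj by (simp add: periodic_trajectory_def h_def[abs_def])
    have per: "u 0 = u T" using traj by (simp add: periodic_trajectory_def)
    have u0: "0 \<le> u t" if "t \<in> {0..T}" for t
    proof (rule nonneg_if_restoring[OF per \<theta>(1) _ that])
      fix t assume t: "t \<in> {0..T}" "u t < 0"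
      have "0 \<le> \<alpha> * v' t" using \<alpha> v_nonneg[OF t(1)] by simp
      then show "\<theta> * min 1 (- u t) \<le> h t"
        unfolding h_def F_neg[OF t(2)] using \<theta> by (intro mult_left_mono) auto
    qed
    have u1: "u t \<le> sup_norm_on T u" if "t \<in> {0..T}" for t
    proof -
      have "bdd_above ((\<lambda>t. \<bar>u t\<bar>) ` {0..T})"
        by (intro bounded_imp_bdd_above compact_imp_bounded compact_continuous_image
            continuous_intros u_cont) simp
      from cSUP_upper[OF that this] show ?thesis by (simp add: sup_norm_on_def)
    qed
    have u\<eta>: "u t \<le> \<eta>" if "t \<in> {0..T}" for t using u1[OF that] le by simp
    have w1: "\<bar>w t\<bar> < M" if "t \<in> {0..T}" for t
    \<comment> \<open>The growth bound is needed only while |w| \<le> M, which is where F and f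
      agree. So the estimate holds for the truncated equation and then shows that the truncation in
      \<xi> is inactive.\<close>
    proof (rule derivative_bound[OF a q m C _ _ M that])
      show "0 \<le> u t \<and> u t \<le> \<eta>" if "t \<in> {0..T}" for t using u0 u\<eta> that by blast
      fix t assume t: "t \<in> {0..T}" and w: "a \<le> \<bar>w t\<bar>" "\<bar>w t\<bar> \<le> M"
      have "q \<bar>w t\<bar> * \<bar>F t (u t) (w t) + \<alpha> * v' t\<bar> \<le> m t + C * \<bar>w t\<bar>"
      proof (cases "t \<in> N")
        case True
        then have "F t (u t) (w t) + \<alpha> * v' t = 0"
          using F_eq[OF u0[OF t] u\<eta>[OF t] w(2)] by (simp add: v'_def)
        then show ?thesis using m(2)[of t] C by simp
      next
        case False
        then have "F t (u t) (w t) + \<alpha> * v' t = f t (u t) (w t) + \<alpha> * v t"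
          using F_eq[OF u0[OF t] u\<eta>[OF t] w(2)] t by (simp add: v'_def)
        then show ?thesis
          using growth'[OF _ u0[OF t] u\<eta>[OF t] w(1) \<alpha>] t False by simp
      qed
      moreover have "\<bar>h t\<bar> \<le> \<bar>F t (u t) (w t) + \<alpha> * v' t\<bar>"
        unfolding h_def abs_mult using \<theta> by (intro mult_left_le_one_le) auto
      moreover have "0 \<le> q \<bar>w t\<bar>" using q(2) w by auto
      ultimately show "q \<bar>w t\<bar> * \<bar>h t\<bar> \<le> m t + C * \<bar>w t\<bar>"
        by (meson mult_left_mono order_trans)
    qed
    have "h t = \<theta> * (f t (u t) (w t) + \<alpha> * v t)" if t: "t \<in> {0..T} - N" for t
      using F_eq[OF u0 u\<eta>, of t "w t" t] w1[of t] t by (simp add: h_def v'_def)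
    then have "AE t in lebesgue_on {0..T}. h t = \<theta> * (f t (u t) (w t) + \<alpha> * v t)"
      unfolding AE_lebesgue_on_iff_negligible using N by blast
    then have "bvp_solution T (\<lambda>t s \<xi>. \<theta> * (f t s \<xi> + \<alpha> * v t)) u"
      by (rule bvp_solutionI[OF _ per])
    with u0 u1 w1 show ?thesis by blast
  qed
  \<comment> \<open>Restricted to \<alpha> = 0, because the linear bound of (f_2) controls f but not
    the forcing.\<close>
  have positive: "0 < u t"
    if traj: "periodic_trajectory \<theta> 0 u w" and \<theta>: "0 < \<theta>" "\<theta> \<le> 1"
      and le: "sup_norm_on T u \<le> \<eta>" and pos: "0 < sup_norm_on T u" and t: "t \<in> {0..T}" for \<theta> u w t
  proof -
    define h where "h t = \<theta> * (F t (u t) (w t) + 0 * v' t)" for t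
    interpret trajectory T h w u majorant
      using traj by (simp add: periodic_trajectory_def h_def[abs_def])
    note ap = apriori[OF traj \<theta> order.refl less_imp_le[OF \<alpha>\<^sub>0] le, THEN conjunct1, rule_format]
    define k' where "k' t = (if t \<in> {0..T} - N then k t else 0)" for t
    have "(\<forall>t\<in>{0..T}. u t = 0) \<or> (\<forall>t\<in>{0..T}. 0 < u t)"
    proof (rule vanishes_or_positive[OF _ _ _ _ \<rho>])
      show "u 0 = u T" using traj by (simp add: periodic_trajectory_def)
      show "0 \<le> u t" if "t \<in> {0..T}" for t using ap[OF that] by simp
      show "k' integrable_on {0..T}"
        by (rule absolutely_integrable_spike_AE[OF in_Lp_absolutely_integrable[OF order.refl k] N])
           (simp add: k'_def)
      show "0 \<le> k' t" for t using k0 by (simp add: k'_def)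
      fix t assume t: "t \<in> {0..T}" "u t \<le> \<rho>" "\<bar>w t\<bar> \<le> \<rho>"
      have "\<bar>h t\<bar> \<le> \<bar>F t (u t) (w t)\<bar>"
        unfolding h_def abs_mult using \<theta> by (simp add: mult_left_le_one_le)
      also have "\<dots> \<le> k' t * (\<bar>u t\<bar> + \<bar>w t\<bar>)"
        using ap[OF t(1)] le F_eq[of "u t" "w t" t] fk[of t "u t" "w t"] t by (auto simp: k'_def)
      finally show "\<bar>h t\<bar> \<le> k' t * (\<bar>u t\<bar> + \<bar>w t\<bar>)" .
    qed
    moreover have "sup_norm_on T u = 0" if "\<forall>t\<in>{0..T}. u t = 0"
    proof -
      have "(\<lambda>t. \<bar>u t\<bar>) ` {0..T} = {0}" using that \<open>T > 0\<close> by (force simp: image_iff)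
      then show ?thesis by (simp add: sup_norm_on_def)
    qed
    ultimately show ?thesis using pos t by force
  qed
  have iterated: "integral {0..T} (\<lambda>s. integral {0..s} (\<lambda>t. F t r 0)) < 0"
  proof -
    have r\<eta>: "0 \<le> r" "\<bar>r\<bar> \<le> max \<eta> M" "\<bar>0\<bar> \<le> max \<eta> M"
      using \<open>r > 0\<close> \<eta> by auto
    have fr: "(\<lambda>t. f t r 0) absolutely_integrable_on {0..s}" if "s \<in> {0..T}" for s
      by (rule set_integrable_subset[OF fint[OF r\<eta>]]) (use that in auto)
    have "(LINT t:{0..s}|lebesgue. f t r 0) = integral {0..s} (\<lambda>t. f t r 0)" if "s \<in> {0..T}" for s
      by (rule set_lebesgue_integral_eq_integral(2)[OF fr[OF that]])
    then have "(LINT s:{0..T}|lebesgue. (LINT t:{0..s}|lebesgue. f t r 0)) =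
        (LINT s:{0..T}|lebesgue. integral {0..s} (\<lambda>t. f t r 0))"
      by (intro set_lebesgue_integral_cong) auto
    also have "\<dots> = integral {0..T} (\<lambda>s. integral {0..s} (\<lambda>t. f t r 0))"
      by (intro set_lebesgue_integral_eq_integral(2) absolutely_integrable_continuous_real
          indefinite_integral_continuous_1 set_lebesgue_integral_eq_integral(1)[OF fint[OF r\<eta>]])
    also have "\<dots> = integral {0..T} (\<lambda>s. integral {0..s} (\<lambda>t. F t r 0))"
    proof (rule integral_cong)
      fix s assume "s \<in> {0..T}"
      then show "integral {0..s} (\<lambda>t. f t r 0) = integral {0..s} (\<lambda>t. F t r 0)"
        using F_eq[of r 0] \<open>r > 0\<close> \<eta> \<open>M > 0\<close> by (intro integral_spike[OF N]) auto
    qed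
    finally show ?thesis using \<open>cond_Hr T f r\<close> by (simp add: cond_Hr_def)
  qed
  \<comment> \<open>At s = -r the field is the constant min 1 r, so the iterated integral is min 1 r
    * T^2 / 2.\<close>
  have "0 < integral {0..T} (\<lambda>s. integral {0..s} (\<lambda>t. F t (- r) 0))"
  proof -
    have "((\<lambda>s. min 1 r * s) has_integral min 1 r * T\<^sup>2 / 2 - min 1 r * 0\<^sup>2 / 2) {0..T}"
      using \<open>T > 0\<close>
      by (intro fundamental_theorem_of_calculus)
         (auto intro!: derivative_eq_intros simp flip: has_real_derivative_iff_has_vector_derivative)
    then have "integral {0..T} (\<lambda>s. min 1 r * s) = min 1 r * T\<^sup>2 / 2" by (simp add: has_integral_iff)
    moreover have "integral {0..T} (\<lambda>s. integral {0..s} (\<lambda>t. F t (- r) 0)) =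
        integral {0..T} (\<lambda>s. min 1 r * s)"
      by (rule integral_cong) (use F_neg[of "- r"] \<open>r > 0\<close> in simp)
    moreover have "0 < min 1 r * T\<^sup>2 / 2" using \<open>T > 0\<close> \<open>r > 0\<close> by simp
    ultimately show ?thesis by linarith
  qed
  from annulus_solution[OF \<open>r > 0\<close> iterated this]
  obtain u w where uw: "periodic_trajectory 1 0 u w" "min r R < sup_norm_on T u" "sup_norm_on T u < max r R"
  proof
    fix \<theta> u w assume \<theta>: "0 < \<theta>" "\<theta> \<le> 1" and traj: "periodic_trajectory \<theta> 0 u w"
    show "sup_norm_on T u \<noteq> r"
    proof
      assume x: "sup_norm_on T u = r"
      have "bvp_solution T (\<lambda>t s \<xi>. \<theta> * f t s \<xi>) u"
        using apriori[OF traj \<theta> order.refl less_imp_le[OF \<alpha>\<^sub>0]] x \<eta> by simp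
      moreover have "\<forall>t\<in>{0..T}. 0 < u t"
        using positive[OF traj \<theta>] x \<eta> \<open>r > 0\<close> by simp
      ultimately show False
        using \<open>cond_Hr T f r\<close> \<theta> x unfolding cond_Hr_def by blast
    qed
  next
    fix \<alpha> u w assume \<alpha>: "0 \<le> \<alpha>" "\<alpha> \<le> \<alpha>\<^sub>0" and traj: "periodic_trajectory 1 \<alpha> u w"
    show "sup_norm_on T u \<noteq> R"
    proof
      assume x: "sup_norm_on T u = R"
      from apriori[OF traj _ _ \<alpha>] x \<eta> have "\<forall>t\<in>{0..T}. 0 \<le> u t"
        "bvp_solution T (\<lambda>t s \<xi>. f t s \<xi> + \<alpha> * v t) u" by auto
      with HR[OF \<alpha>] x show False by blast
    qed
  next
    fix u w assume traj: "periodic_trajectory 1 \<alpha>\<^sub>0 u w"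
    show "\<not> sup_norm_on T u \<le> R"
    proof
      assume x: "sup_norm_on T u \<le> R"
      from apriori[OF traj _ _ less_imp_le[OF \<alpha>\<^sub>0] order.refl] x \<eta>
      have "\<forall>t\<in>{0..T}. 0 \<le> u t \<and> u t \<le> sup_norm_on T u"
        "bvp_solution T (\<lambda>t s \<xi>. f t s \<xi> + \<alpha>\<^sub>0 * v t) u" by auto
      with none x show False by (meson order_trans)
    qed
  qed blast
  have le: "sup_norm_on T u \<le> \<eta>" using uw(3) by (simp add: \<eta>_def)
  have "bvp_solution T f u"
    using apriori[OF uw(1) _ _ order.refl less_imp_le[OF \<alpha>\<^sub>0] le] by simp
  moreover have pos: "0 < u t" if "t \<in> {0..T}" for t
    using positive[OF uw(1) _ _ le _ that] uw(2) \<open>r > 0\<close> \<open>R > 0\<close> by simp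
  moreover have "(SUP t\<in>{0..T}. u t) = sup_norm_on T u"
    unfolding sup_norm_on_def by (rule SUP_cong) (use pos in \<open>auto simp: less_imp_le\<close>)
  ultimately show ?thesis using uw by (intro exI[of _ u]) auto
qed

end
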